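(* Let $C/\mathbb Q$ be the affine curve defined by $y^2=2(x^4+2x^3-2x+1)$, $z^2=5x^4+8x^3+6x^2-8x+5$. Then: (1) $C(\mathbb Q)=\{(\pm1,\pm2,\pm4)\}$ (all sign choices); (2) if $K$ is a quadratic field different from $\mathbb Q(\sqrt5)$ and $\mathbb Q(\sqrt{17})$, then $C(K)=C(\mathbb Q)$; (3) for $K=\mathbb Q(\sqrt5)$, $C(K)\setminus C(\mathbb Q)=\{(x,\pm(4x-2),\pm8x): x^2+4x-1=0\}$; (4) for $K=\mathbb Q(\sqrt{17})$, $C(K)\setminus C(\mathbb Q)$ consists of the points $(-3,\pm2\sqrt{17},\pm4\sqrt{17})$, $(1/3,\pm2\sqrt{17}/9,\pm4\sqrt{17}/9)$, and the points $(x,\pm10x,\pm(16x-4))$ with $x^2+8x-1=0$.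
   Context: For a field $K\supseteq\mathbb Q$, $C(K)$ denotes the set of triples $(x,y,z)\in K^3$ satisfying both equations. *)

theory Defs
  imports Complex_Main "HOL-Algebra.Generated_Fields" "HOL-Algebra.Algebraic_Closure_Type"
begin

text \<open>
  Fields \<open>K \<supseteq> \<rat>\<close> are subfields of an arbitrary ambient field \<open>'a\<close> of characteristic 0;
  \<open>\<rat> :: 'a set\<close> is then the prime field. With \<open>K = UNIV\<close> this includes abstract fields.
  \<open>ring_of_type_algebra\<close> is the type \<open>'a\<close> viewed as a ring record.
\<close>

definition curve_points :: "'a::field_char_0 set \<Rightarrow> ('a \<times> 'a \<times> 'a) set" where
  "curve_points K = {(x, y, z). x \<in> K \<and> y \<in> K \<and> z \<in> K \<and>
     y^2 = 2 * (x^4 + 2 * x^3 - 2 * x + 1) \<and>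
     z^2 = 5 * x^4 + 8 * x^3 + 6 * x^2 - 8 * x + 5}"

definition quadratic_field :: "'a::field_char_0 set \<Rightarrow> bool" where
  "quadratic_field K \<longleftrightarrow>
     subfield K ring_of_type_algebra \<and> ring.dimension ring_of_type_algebra 2 \<rat> K"

text \<open>
  The field \<open>\<rat>(s)\<close>: in characteristic 0 every subfield contains \<open>\<rat>\<close>, so
  \<open>{s}\<close> suffices as generating set.
\<close>

definition rat_adjoin :: "'a::field_char_0 \<Rightarrow> 'a set" where
  "rat_adjoin s = generate_field ring_of_type_algebra {s}"

end

theory Submission
  imports Defs "HOL-Computational_Algebra.Nth_Powers"
begin

text \<open>
  Put \<open>t = x - 1/x\<close>, \<open>A = x + 1/x\<close>, \<open>Y = y/x\<close>, \<open>Z = z/x\<close>. Then \<open>A\<^sup>2 = t\<^sup>2 + 4\<close>,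
  \<open>Y\<^sup>2 = 2t\<^sup>2 + 4t + 4\<close> and \<open>Z\<^sup>2 = 5t\<^sup>2 + 8t + 16\<close> are three quadrics, diagonal apart from \<open>t\<close>.
  For two of them, the discriminant of a member of their pencil defines an elliptic curve
  \<open>w\<^sup>2 = \<alpha>\<beta>(\<alpha>\<^sup>2 + (2e+1)\<alpha>\<beta> + e\<^sup>2\<beta>\<^sup>2)\<close> with \<open>e = 1\<close> or \<open>e = 4\<close>. Infinite descent on its
  2-isogenous curve \<open>w\<^sup>2 = p(p - 1)(p - 4e - 1)\<close> shows that \<open>\<alpha> = -e\<beta>\<close> is the only rational
  possibility with \<open>\<alpha>\<beta> \<noteq> 0\<close>. If \<open>t\<close> is rational, two of \<open>A, Y, Z\<close> have rational product, which
  gives a rational point on such a curve and leaves only \<open>t = 0, -4, -8, -8/3\<close>. If \<open>t\<close> is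
  irrational, a point and its conjugate span a rational line, which lies on one quadric of each
  pencil; the resulting two quadrics are then fully determined and contain no suitable line.
\<close>

section \<open>Coprime factors of squares, and squares modulo 4 and 8\<close>

lemma coprime_mult_square_int:
  fixes x y z :: int
  assumes "coprime x y" "x * y = z\<^sup>2" "x > 0"
  obtains r where "x = r\<^sup>2"
proof (cases "y = 0")
  \<comment> \<open>Coprimality to 0 makes the positive integer \<open>x\<close> a unit, so
    \<open>x = 1\<close>.\<close>
  case True
  then show thesis using assms that[of 1] by auto
next
  case False
  then have "y > 0"
    using assms by (metis zero_le_power2 zero_le_mult_iff order.order_iff_strict not_less)
  have "int (nat x * nat y) = int ((nat \<bar>z\<bar>) ^ 2)"
    using assms \<open>y > 0\<close> by simp
  then have "nat x * nat y = (nat \<bar>z\<bar>) ^ 2"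
    by (simp only: of_nat_eq_iff)
  moreover have "coprime (nat x) (nat y)"
    using assms \<open>y > 0\<close> by (metis coprime_int_iff int_nat_eq order_less_imp_le)
  ultimately have "is_nth_power 2 (nat x)"
    using is_nth_power_mult_coprime_natD(1)[of "nat x" "nat y" 2] assms(3) \<open>y > 0\<close>
    by (simp add: is_nth_power_nth_power)
  then obtain r where "nat x = r ^ 2"
    by (auto simp: is_nth_power_def)
  then have "x = (int r)\<^sup>2"
    using assms(3) by (metis int_nat_eq of_nat_power order_less_imp_le)
  then show thesis by (rule that)
qed

lemma coprime_add_diffI:
  fixes x y :: int
  assumes "coprime (x + y) (x - y)"
  shows "coprime x y"
  using assms by (metis coprimeI coprime_common_divisor dvd_add dvd_diff)

text \<open>A common divisor of sum and difference divides \<open>2 * x\<close> and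
  \<open>2 * y\<close>, and it is odd because the sum is.\<close>

lemma coprime_add_diff_odd:
  fixes x y :: int
  assumes "coprime x y" "odd (x + y)"
  shows "coprime (x + y) (x - y)"
proof (rule coprimeI)
  fix d assume d: "d dvd x + y" "d dvd x - y"
  have "coprime d 2"
    using d(1) assms(2) by (metis coprime_right_2_iff_odd dvd_trans)
  moreover have "d dvd (x + y) + (x - y)" "d dvd (x + y) - (x - y)"
    using d by (simp_all only: dvd_add dvd_diff)
  ultimately have "d dvd x" "d dvd y"
    by (simp_all add: coprime_dvd_mult_right_iff flip: mult_2)
  then show "is_unit d" using assms(1) coprime_common_divisor by blast
qed

lemma odd_square_mod_8:
  fixes x :: int
  assumes "odd x"
  shows "x\<^sup>2 mod 8 = 1"
proof -
  obtain k where k: "x = 2 * k + 1" using assms by (rule oddE)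
  have "even (k * (k + 1))" by simp
  then obtain j where "k * (k + 1) = 2 * j" by (rule evenE)
  then have "x\<^sup>2 = 8 * j + 1" unfolding k by (simp add: power2_eq_square algebra_simps)
  then show ?thesis by simp
qed

lemma square_mod_4:
  fixes x :: int
  shows "x\<^sup>2 mod 4 = (if even x then 0 else 1)"
proof (cases "even x")
  case True
  then obtain k where "x = 2 * k" by (rule evenE)
  then show ?thesis by (simp add: power2_eq_square)
next
  case False
  then have "x\<^sup>2 mod 8 = 1" by (rule odd_square_mod_8)
  then have "x\<^sup>2 mod 4 = 1" by presburger
  then show ?thesis using False by simp
qed

section \<open>Infinite descent for \<open>a^2 - b^2\<close> and
  \<open>a^2 - (c^2 + 1) * b^2\<close>\<close>

text \<open>The square of a common divisor of \<open>a\<close> and \<open>u\<close> divides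
  \<open>n * b^2\<close> and is prime to \<open>b\<close>, so it divides the squarefree
  \<open>n\<close>.\<close>

lemma coprime_sq_diff:
  fixes a b u n :: int
  assumes "coprime a b" "a\<^sup>2 - n * b\<^sup>2 = u\<^sup>2" "squarefree n"
  shows "coprime a u"
proof (rule coprimeI)
  fix d assume d: "d dvd a" "d dvd u"
  then have "d\<^sup>2 dvd a\<^sup>2 - u\<^sup>2" by (intro dvd_diff dvd_power_same)
  then have "d\<^sup>2 dvd n * b\<^sup>2" using assms(2) by (simp add: algebra_simps)
  moreover have "coprime d b" using d(1) assms(1) by (metis coprime_divisors dvd_refl)
  ultimately have "d\<^sup>2 dvd n" by (simp add: coprime_dvd_mult_left_iff)
  then show "is_unit d" using assms(3) by (simp add: squarefree_def)
qed

lemma even_add_obtain: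
  fixes x y :: int
  assumes "even (x + y)"
  obtains p q where "x = p + q" "y = p - q"
proof -
  obtain p where "x + y = 2 * p" using assms by (rule evenE)
  then show thesis by (intro that[of p "x - p"]) auto
qed

text \<open>
  The point \<open>x = a\<^sup>2/b\<^sup>2\<close> of \<open>w\<^sup>2 = x (x - 1) (x - c\<^sup>2 - 1)\<close> is halved: one half has
  \<open>x\<close>-coordinate \<open>(a + u) (a + v)/b\<^sup>2 = p\<^sup>2/h\<^sup>2\<close>.
\<close>

lemma descent_step_parametrized:
  fixes a b u v c k g h p r :: int
  assumes "a > 0" "b > 0" "u > 0" "k > 0"
    and u: "a\<^sup>2 - b\<^sup>2 = u\<^sup>2" and v: "a\<^sup>2 - (c\<^sup>2 + 1) * b\<^sup>2 = v\<^sup>2"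
    and par: "a + u = k * g\<^sup>2" "a - u = k * h\<^sup>2" "a + v = k * p\<^sup>2" "u + v = k * r\<^sup>2"
  shows "h \<noteq> 0" "\<bar>h\<bar> < b" "p\<^sup>2 - h\<^sup>2 = r\<^sup>2" "\<exists>s. p\<^sup>2 - (c\<^sup>2 + 1) * h\<^sup>2 = s\<^sup>2"
proof -
  have b: "b\<^sup>2 = k\<^sup>2 * g\<^sup>2 * h\<^sup>2"
  proof -
    have "b\<^sup>2 = (a + u) * (a - u)" using u by (simp add: power2_eq_square algebra_simps)
    then show ?thesis unfolding par by (simp add: power2_eq_square algebra_simps)
  qed
  show h: "h \<noteq> 0" using b assms(2) by auto
  \<comment> \<open>Strict decrease: \<open>b^2\<close> is \<open>h^2\<close> times
    \<open>k^2 * g^2\<close>, and this factor exceeds 1 because \<open>k * g^2 = a + u\<close> is at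
    least 2.\<close>
  have "k * g\<^sup>2 \<ge> 2" using assms(1,3) par(1) by linarith
  moreover have "(k * g\<^sup>2) * 1 \<le> (k * g\<^sup>2) * k"
    using assms(4) by (intro mult_left_mono) auto
  ultimately have "k\<^sup>2 * g\<^sup>2 > 1" by (simp add: power2_eq_square algebra_simps)
  then have "1 * h\<^sup>2 < k\<^sup>2 * g\<^sup>2 * h\<^sup>2" using h by (intro mult_strict_right_mono) auto
  then have "\<bar>h\<bar>\<^sup>2 < b\<^sup>2" using b by simp
  then show "\<bar>h\<bar> < b" using assms(2) power2_less_imp_less by fastforce
  have "k * (p\<^sup>2 - h\<^sup>2) = k * r\<^sup>2" using par by (simp add: algebra_simps)
  then show "p\<^sup>2 - h\<^sup>2 = r\<^sup>2" using assms(4) by simp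
  \<comment> \<open>The products \<open>(a + u) * (a + v)\<close> and
    \<open>(a + v) * (u + v)\<close> differ by \<open>a^2 - v^2 = (c^2 + 1) * b^2\<close>. Hence
    \<open>p^2 - (c^2 + 1) * h^2\<close> times a nonzero square is a square.\<close>
  have "k\<^sup>2 * (g\<^sup>2 * (p\<^sup>2 - (c\<^sup>2 + 1) * h\<^sup>2)) = (a + u) * (a + v) - (c\<^sup>2 + 1) * b\<^sup>2"
    unfolding par b by (simp add: power2_eq_square algebra_simps)
  also have "\<dots> = (a + v) * (u + v)"
    using u v by (simp add: power2_eq_square algebra_simps)
  also have "\<dots> = k\<^sup>2 * (p * r)\<^sup>2"
    unfolding par by (simp add: power2_eq_square algebra_simps)
  finally have *: "g\<^sup>2 * (p\<^sup>2 - (c\<^sup>2 + 1) * h\<^sup>2) = (p * r)\<^sup>2"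
    using assms(4) by simp
  then have "g\<^sup>2 dvd (p * r)\<^sup>2" by (metis dvd_triv_left)
  then obtain s where "p * r = g * s" by (auto simp: pow_divides_pow_iff)
  moreover have "g \<noteq> 0" using b assms(2) by auto
  ultimately have "p\<^sup>2 - (c\<^sup>2 + 1) * h\<^sup>2 = s\<^sup>2" using * by (simp add: power_mult_distrib)
  then show "\<exists>s. p\<^sup>2 - (c\<^sup>2 + 1) * h\<^sup>2 = s\<^sup>2" ..
qed

text \<open>Supplies the parameters of \<open>descent_step_parametrized\<close>, with
  \<open>k = 2\<close> for even \<open>b\<close> and \<open>k = 1\<close> for odd \<open>b\<close>.
  Each of \<open>a + u\<close>, \<open>a - u\<close>, \<open>a + v\<close>, \<open>u + v\<close> is
  a power of 2 times one of two coprime factors of a square. The divisibility hypothesis fixes the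
  sign of \<open>v\<close>: the prime \<open>c^2 + 1\<close> is absorbed by \<open>a - v\<close>, so
  that \<open>a + v\<close> needs no such factor.\<close>

lemma descent_step:
  fixes a b u v c :: int
  assumes c: "c = 2 \<or> c = 4" and ab: "coprime a b" and pos: "a > 0" "b > 0" "u > 0"
    and u: "a\<^sup>2 - b\<^sup>2 = u\<^sup>2" and v: "a\<^sup>2 - (c\<^sup>2 + 1) * b\<^sup>2 = v\<^sup>2"
    and dvd: "c\<^sup>2 + 1 dvd a - v"
  shows "\<exists>h p r s. h \<noteq> 0 \<and> \<bar>h\<bar> < b \<and> p\<^sup>2 - h\<^sup>2 = r\<^sup>2 \<and> p\<^sup>2 - (c\<^sup>2 + 1) * h\<^sup>2 = s\<^sup>2"
proof -
  define n where "n = c\<^sup>2 + 1"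
  have n: "n = 5 \<or> n = 17" using c unfolding n_def by auto
  then have "squarefree n" by (auto intro!: squarefree_prime)
  have u': "a\<^sup>2 - 1 * b\<^sup>2 = u\<^sup>2" using u by simp
  have au: "coprime a u" using coprime_sq_diff[OF ab u'] by simp
  have av: "coprime a v" using coprime_sq_diff[OF ab v[folded n_def] \<open>squarefree n\<close>] .
  have b2: "b\<^sup>2 > 0" using pos by simp
  have uv: "u\<^sup>2 - v\<^sup>2 = (c * b)\<^sup>2" using u v by (simp add: power2_eq_square algebra_simps)
  have "(c * b)\<^sup>2 > 0" using c pos by auto
  then have "\<bar>u\<bar>\<^sup>2 < a\<^sup>2" "\<bar>v\<bar>\<^sup>2 < u\<^sup>2"
    using u uv b2 unfolding power2_abs by linarith+
  then have less: "u < a" "\<bar>v\<bar> < u"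
    using pos power2_less_imp_less[of "\<bar>u\<bar>" a] power2_less_imp_less[of "\<bar>v\<bar>" u] by auto
  have main: ?thesis if "k > 0" "a + u = k * g\<^sup>2" "a - u = k * h\<^sup>2" "a + v = k * p\<^sup>2" "u + v = k * r\<^sup>2"
    for k g h p r
    using descent_step_parametrized[OF pos that(1) u v that(2-)] by blast
  show ?thesis
  proof (cases "even b")
    case True
    then obtain b' where b': "b = 2 * b'" by (rule evenE)
    have "odd a" using ab True by (metis coprime_common_divisor odd_one)
    then have "odd (u\<^sup>2)" "odd (v\<^sup>2)" unfolding u[symmetric] v[symmetric] using True by simp_all
    then have "odd u" "odd v" by simp_all
    obtain A1 A2 where A: "a = A1 + A2" "u = A1 - A2"
      using even_add_obtain[of a u] \<open>odd a\<close> \<open>odd u\<close> by auto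
    obtain P1 P2 where P: "a = P1 + P2" "v = P1 - P2"
      using even_add_obtain[of a v] \<open>odd a\<close> \<open>odd v\<close> by auto
    obtain R1 R2 where R: "u = R1 + R2" "v = R1 - R2"
      using even_add_obtain[of u v] \<open>odd u\<close> \<open>odd v\<close> by auto
    have "A1 * A2 = b'\<^sup>2" using u unfolding A b' by (simp add: power2_eq_square algebra_simps)
    moreover have cA: "coprime A1 A2" using au unfolding A by (rule coprime_add_diffI)
    moreover have "A1 > 0" "A2 > 0" using A less pos by auto
    ultimately obtain g h where "A1 = g\<^sup>2" "A2 = h\<^sup>2"
      by (metis coprime_mult_square_int coprime_commute mult.commute)
    have "n dvd 2 * P2" using dvd unfolding n_def P by (simp add: algebra_simps)
    moreover have "coprime n 2" using n by auto
    ultimately have "n dvd P2" by (simp add: coprime_dvd_mult_right_iff)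
    then obtain P3 where P3: "P2 = n * P3" by (rule dvdE)
    have "n * (P1 * P3) = n * b'\<^sup>2"
      using v unfolding n_def[symmetric] unfolding P b' P3 by (simp add: power2_eq_square algebra_simps)
    then have "P1 * P3 = b'\<^sup>2" using n by auto
    moreover have "coprime P1 P3"
      using coprime_add_diffI[of P1 P2] av unfolding P P3 by simp
    moreover have "P1 > 0" using P less pos by auto
    ultimately obtain p where "P1 = p\<^sup>2" by (metis coprime_mult_square_int)
    have "R1 * R2 = (c * b')\<^sup>2" using uv unfolding R b' by (simp add: power2_eq_square algebra_simps)
    \<comment> \<open>A common divisor of \<open>u\<close> and \<open>v\<close> is odd and prime to
      \<open>b\<close>, and its square divides \<open>(c * b)^2\<close>; so it divides
      \<open>c\<close>, a power of 2.\<close>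
    moreover have "coprime R1 R2"
    proof (rule coprime_add_diffI, fold R, rule coprimeI)
      fix d assume d: "d dvd u" "d dvd v"
      have "coprime d 2" using d(1) \<open>odd u\<close> by (metis coprime_right_2_iff_odd dvd_trans)
      have "coprime d b"
      proof (rule coprimeI)
        fix e assume "e dvd d" "e dvd b"
        then have "e dvd u" using d by auto
        then have "e\<^sup>2 dvd u\<^sup>2 + b\<^sup>2" using \<open>e dvd b\<close> by (intro dvd_add dvd_power_same)
        then have "e\<^sup>2 dvd a\<^sup>2" using u by (simp add: algebra_simps)
        then have "e dvd a" by (simp add: pow_divides_pow_iff)
        then show "is_unit e" using \<open>e dvd u\<close> au coprime_common_divisor by blast
      qed
      have "d\<^sup>2 dvd u\<^sup>2 - v\<^sup>2" using d by (intro dvd_diff dvd_power_same)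
      then have "d dvd c * b" unfolding uv by (simp add: pow_divides_pow_iff)
      then have "d dvd c" using \<open>coprime d b\<close> by (simp add: coprime_dvd_mult_left_iff)
      then have "d dvd 2 ^ 2" using c by (auto intro: dvd_trans)
      then show "is_unit d" using \<open>coprime d 2\<close> by (metis coprime_power_right_iff coprime_dvd_mult_right_iff coprime_common_divisor dvd_refl)
    qed
    moreover have "R1 > 0" using R less by auto
    ultimately obtain r where "R1 = r\<^sup>2" by (metis coprime_mult_square_int)
    show ?thesis
      by (rule main[of 2 g h p r]) (use A P R \<open>A1 = g\<^sup>2\<close> \<open>A2 = h\<^sup>2\<close> \<open>P1 = p\<^sup>2\<close> \<open>R1 = r\<^sup>2\<close> in auto)
  next
    \<comment> \<open>For odd \<open>b\<close>, congruences modulo 8 show that 4 divides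
      \<open>u\<close>, and \<open>c = 2\<close> fails modulo 4. For \<open>c = 4\<close> also 4
      divides \<open>v\<close>, and dividing by 16 leaves \<open>u1^2 - v1^2 = b^2\<close>.\<close>
    case False
    have "odd a"
    proof
      assume "even a"
      then have "(u\<^sup>2 + b\<^sup>2) mod 4 = 0" using u square_mod_4[of a] by (simp add: algebra_simps)
      then show False using False square_mod_4[of u] square_mod_4[of b] by (auto split: if_splits) presburger+
    qed
    have "even (u\<^sup>2)" unfolding u[symmetric] using False \<open>odd a\<close> by simp
    then have "even u" by simp
    then obtain u' where u': "u = 2 * u'" by (rule evenE)
    have "u\<^sup>2 mod 8 = 0"
      using u odd_square_mod_8[OF False] odd_square_mod_8[OF \<open>odd a\<close>] by presburger
    then have "u'\<^sup>2 mod 4 \<noteq> 1" unfolding u' by (simp add: power2_eq_square) presburger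
    then have "even u'" using square_mod_4[of u'] by (auto split: if_splits)
    then obtain u1 where u1: "u = 4 * u1" unfolding u' by (auto elim: evenE)
    have "c = 4"
    proof (rule ccontr)
      assume "c \<noteq> 4"
      then have c2: "c = 2" using c by simp
      have "even (v\<^sup>2)" unfolding v[symmetric] c2 using False \<open>odd a\<close> by simp
      then have "even v" by simp
      then obtain v' where v': "v = 2 * v'" by (rule evenE)
      have "v'\<^sup>2 = 4 * u1\<^sup>2 - b\<^sup>2" using uv unfolding u1 v' c2 by (simp add: power2_eq_square)
      then show False using False square_mod_4[of v'] square_mod_4[of b] by (auto split: if_splits) presburger+
    qed
    have "4\<^sup>2 * (u1\<^sup>2 - b\<^sup>2) = v\<^sup>2" using uv unfolding u1 \<open>c = 4\<close> by (simp add: power2_eq_square)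
    then have "4\<^sup>2 dvd v\<^sup>2" by (metis dvd_triv_left)
    then have "4 dvd v" by (simp only: pow_divides_pow_iff pos2)
    then obtain v1 where v1: "v = 4 * v1" by (rule dvdE)
    have b1: "(u1 + v1) * (u1 - v1) = b\<^sup>2" using uv unfolding u1 v1 \<open>c = 4\<close> by (simp add: power2_eq_square algebra_simps)
    have "coprime u1 v1"
    proof (rule coprimeI)
      fix d assume d: "d dvd u1" "d dvd v1"
      then have "d * d dvd (u1 + v1) * (u1 - v1)" by (intro mult_dvd_mono) auto
      then have "d dvd b" unfolding b1 by (simp add: pow_divides_pow_iff flip: power2_eq_square)
      then have "d\<^sup>2 dvd u\<^sup>2 + b\<^sup>2" using d u1 by (intro dvd_add dvd_power_same) auto
      then have "d\<^sup>2 dvd a\<^sup>2" using u by (simp add: algebra_simps)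
      then have "d dvd a" by (simp add: pow_divides_pow_iff)
      then show "is_unit d" using \<open>d dvd b\<close> ab coprime_common_divisor by blast
    qed
    moreover have "odd (u1 + v1)" using b1 False by (metis even_mult_iff even_power)
    ultimately have "coprime (u1 + v1) (u1 - v1)" by (rule coprime_add_diff_odd)
    moreover have "u1 + v1 > 0" using less u1 v1 by auto
    ultimately obtain r where r: "u1 + v1 = r\<^sup>2" using b1 by (metis coprime_mult_square_int)
    have "(a + u) * (a - u) = b\<^sup>2" using u by (simp add: power2_eq_square algebra_simps)
    moreover have "coprime (a + u) (a - u)" using au \<open>odd a\<close> \<open>even u\<close> by (intro coprime_add_diff_odd) auto
    ultimately obtain g h where gh: "a + u = g\<^sup>2" "a - u = h\<^sup>2"
      using less pos by (metis coprime_mult_square_int coprime_commute mult.commute add_pos_pos diff_gt_0_iff_gt)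
    obtain P3 where P3: "a - v = n * P3" using dvd unfolding n_def by (rule dvdE)
    have "n * ((a + v) * P3) = (a + v) * (a - v)" unfolding P3 by simp
    also have "\<dots> = n * b\<^sup>2" using v unfolding n_def[symmetric] by (simp add: power2_eq_square algebra_simps)
    finally have "(a + v) * P3 = b\<^sup>2" using n by auto
    moreover have "coprime (a + v) (a - v)" using av \<open>odd a\<close> v1 by (intro coprime_add_diff_odd) auto
    then have "coprime (a + v) P3" unfolding P3 by simp
    moreover have "a + v > 0" using less by auto
    ultimately obtain p where p: "a + v = p\<^sup>2" by (metis coprime_mult_square_int)
    \<comment> \<open>The witness \<open>2 * r\<close> reflects
      \<open>u + v = 4 * (u1 + v1)\<close>.\<close>
    show ?thesis
      by (rule main[of 1 g h p "2 * r"]) (use gh p r u1 v1 in \<open>auto simp: power_mult_distrib\<close>)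
  qed
qed

text \<open>Infinite descent on the absolute value of \<open>b\<close>. Dividing out the gcd and
  choosing the sign of \<open>v\<close> gives the hypotheses of \<open>descent_step\<close>, which
  returns a solution with smaller nonzero second entry.\<close>

lemma concordant_forms:
  fixes a b u v c :: int
  assumes c: "c = 2 \<or> c = 4" and "a\<^sup>2 - b\<^sup>2 = u\<^sup>2" "a\<^sup>2 - (c\<^sup>2 + 1) * b\<^sup>2 = v\<^sup>2"
  shows "b = 0"
  using assms(2,3)
proof (induction "nat \<bar>b\<bar>" arbitrary: a b u v rule: less_induct)
  case less
  show ?case
  proof (rule ccontr)
    assume "b \<noteq> 0"
    define d where "d = gcd a b"
    have "d > 0" using \<open>b \<noteq> 0\<close> unfolding d_def by simp
    obtain a' b' where ab: "a = d * a'" "b = d * b'" "coprime a' b'"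
      using gcd_coprime_exists[of a b] \<open>b \<noteq> 0\<close> unfolding d_def by (auto simp: mult.commute)
    have "d\<^sup>2 * (a'\<^sup>2 - b'\<^sup>2) = u\<^sup>2" "d\<^sup>2 * (a'\<^sup>2 - (c\<^sup>2 + 1) * b'\<^sup>2) = v\<^sup>2"
      using less.prems unfolding ab by (simp_all add: power_mult_distrib algebra_simps)
    moreover from this have "d\<^sup>2 dvd u\<^sup>2" "d\<^sup>2 dvd v\<^sup>2" by (metis dvd_triv_left)+
    then have "d dvd u" "d dvd v" by (simp_all add: pow_divides_pow_iff)
    then obtain u' v' where uv: "u = d * u'" "v = d * v'" by (elim dvdE)
    ultimately have eqs: "a'\<^sup>2 - b'\<^sup>2 = u'\<^sup>2" "a'\<^sup>2 - (c\<^sup>2 + 1) * b'\<^sup>2 = v'\<^sup>2"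
      using \<open>d > 0\<close> by (simp_all add: power_mult_distrib)
    have b': "b' \<noteq> 0" using \<open>b \<noteq> 0\<close> ab by auto
    then have "b'\<^sup>2 > 0" by simp
    have le: "\<bar>b'\<bar> \<le> \<bar>b\<bar>" using \<open>d > 0\<close> unfolding ab by (simp add: abs_mult mult_le_cancel_right1)
    have "u' \<noteq> 0"
    proof
      assume "u' = 0"
      then have "c\<^sup>2 * b'\<^sup>2 + v'\<^sup>2 = 0" using eqs by (simp add: algebra_simps)
      then show False using c b' by (auto simp: add_nonneg_eq_0_iff)
    qed
    have "a' \<noteq> 0" using eqs(1) \<open>b'\<^sup>2 > 0\<close> by (smt (verit) zero_le_power2 power_zero_numeral)
    define n where "n = c\<^sup>2 + 1"
    have "prime n" using c unfolding n_def by auto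
    have "(\<bar>a'\<bar> - v') * (\<bar>a'\<bar> + v') = a'\<^sup>2 - v'\<^sup>2"
      by (simp add: algebra_simps power2_eq_square)
    also have "\<dots> = n * b'\<^sup>2" using eqs(2) unfolding n_def by simp
    finally have "n dvd (\<bar>a'\<bar> - v') * (\<bar>a'\<bar> + v')" by simp
    then have "n dvd \<bar>a'\<bar> - v' \<or> n dvd \<bar>a'\<bar> - (- v')"
      using \<open>prime n\<close> by (simp add: prime_dvd_mult_iff)
    \<comment> \<open>The prime \<open>n\<close> is 5 or 17 and divides one of the two factors;
      negating \<open>v'\<close> if necessary makes that factor the difference.\<close>
    then obtain w where w: "w\<^sup>2 = v'\<^sup>2" "n dvd \<bar>a'\<bar> - w" by (metis power2_minus)
    have "\<exists>h p r s. h \<noteq> 0 \<and> \<bar>h\<bar> < \<bar>b'\<bar> \<and> p\<^sup>2 - h\<^sup>2 = r\<^sup>2 \<and> p\<^sup>2 - (c\<^sup>2 + 1) * h\<^sup>2 = s\<^sup>2"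
      by (rule descent_step[of c "\<bar>a'\<bar>" "\<bar>b'\<bar>" "\<bar>u'\<bar>" w])
        (use c ab eqs w \<open>a' \<noteq> 0\<close> \<open>u' \<noteq> 0\<close> b' in \<open>auto simp: n_def\<close>)
    then obtain h p r s where "h \<noteq> 0" "\<bar>h\<bar> < \<bar>b'\<bar>" "p\<^sup>2 - h\<^sup>2 = r\<^sup>2" "p\<^sup>2 - (c\<^sup>2 + 1) * h\<^sup>2 = s\<^sup>2"
      by blast
    moreover from this le have "nat \<bar>h\<bar> < nat \<bar>b\<bar>" by auto
    ultimately show False using less.hyps by blast
  qed
qed

section \<open>Rational points on the elliptic curves\<close>

text \<open>A 2-descent: the gcd \<open>d\<close> of the two factors divides \<open>c^2\<close>, and
  the cofactors are squares up to a common sign \<open>e\<close>. A square \<open>d\<close> reduces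
  to \<open>concordant_forms\<close>; the values 2 and 8 contradict congruences modulo powers of
  2.\<close>

lemma quartic_int_points:
  fixes a b c w :: int
  assumes c: "c = 2 \<or> c = 4" and ab: "coprime a b" and "b \<noteq> 0"
    and w: "(a\<^sup>2 - b\<^sup>2) * (a\<^sup>2 - (c\<^sup>2 + 1) * b\<^sup>2) = w\<^sup>2"
  shows "a\<^sup>2 = b\<^sup>2"
proof (rule ccontr)
  assume neq: "a\<^sup>2 \<noteq> b\<^sup>2"
  define M N where "M = a\<^sup>2 - b\<^sup>2" and "N = a\<^sup>2 - (c\<^sup>2 + 1) * b\<^sup>2"
  have "M \<noteq> 0" using neq unfolding M_def by simp
  define d where "d = gcd M N"
  have "d > 0" using \<open>M \<noteq> 0\<close> unfolding d_def by simp
  obtain M1 N1 where MN: "M = d * M1" "N = d * N1" "coprime M1 N1"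
    using gcd_coprime_exists[of M N] \<open>M \<noteq> 0\<close> unfolding d_def by (auto simp: mult.commute)
  have "d\<^sup>2 * (M1 * N1) = w\<^sup>2"
    using w unfolding M_def[symmetric] N_def[symmetric] MN by (simp add: power2_eq_square algebra_simps)
  moreover from this have "d\<^sup>2 dvd w\<^sup>2" by (metis dvd_triv_left)
  then have "d dvd w" by (simp add: pow_divides_pow_iff)
  then obtain w1 where "w = d * w1" by (rule dvdE)
  ultimately have w1: "M1 * N1 = w1\<^sup>2" using \<open>d > 0\<close> by (simp add: power_mult_distrib)
  have "d dvd c\<^sup>2"
  proof -
    have "c\<^sup>2 * b\<^sup>2 = M - N" "c\<^sup>2 * a\<^sup>2 = (c\<^sup>2 + 1) * M - N"
      unfolding M_def N_def by (simp_all add: algebra_simps)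
    then have "d dvd c\<^sup>2 * b\<^sup>2" "d dvd c\<^sup>2 * a\<^sup>2" by (simp_all add: MN)
    then have "d dvd gcd (c\<^sup>2 * a\<^sup>2) (c\<^sup>2 * b\<^sup>2)" by simp
    also have "gcd (c\<^sup>2 * a\<^sup>2) (c\<^sup>2 * b\<^sup>2) = c\<^sup>2" using ab by (simp add: gcd_mult_left)
    finally show ?thesis .
  qed
  have d_cases: "d = 1 \<or> d = 2 \<and> c = 2 \<or> d = 4 \<or> c = 4 \<and> d \<in> {2, 8, 16}"
  proof -
    have "d dvd 4 \<or> c = 4 \<and> d dvd 16" using \<open>d dvd c\<^sup>2\<close> c by auto
    moreover have "d \<in> set [1..16]"
      using \<open>d > 0\<close> zdvd_imp_le[OF \<open>d dvd c\<^sup>2\<close>] c by auto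
    ultimately show ?thesis using c \<open>d dvd c\<^sup>2\<close> by (auto simp: upto_rec1)
  qed
  have odd: "odd a \<and> odd b" if "even d"
  proof -
    have "even M" using that MN by simp
    then have "even a = even b" unfolding M_def by simp
    then show ?thesis using ab by (metis coprime_common_divisor odd_one)
  qed
  have M8: "8 dvd M" if "even d"
    unfolding M_def mod_eq_dvd_iff[symmetric] using odd[OF that] by (simp add: odd_square_mod_8)
  obtain e x y where exy: "e = 1 \<or> e = - 1" "M1 = e * x\<^sup>2" "N1 = e * y\<^sup>2"
  proof (cases "M1 > 0")
    case True
    then have "N1 \<ge> 0" using w1 by (metis zero_le_power2 zero_le_mult_iff not_less)
    obtain x where "M1 = x\<^sup>2" using coprime_mult_square_int MN(3) w1 True by metis
    moreover obtain y where "N1 = y\<^sup>2"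
    proof (cases "N1 = 0")
      case False
      then show ?thesis
        using coprime_mult_square_int[of N1 M1 w1] MN(3) w1 \<open>N1 \<ge> 0\<close> that
        by (auto simp: coprime_commute mult.commute)
    qed (use that[of 0] in simp)
    ultimately show thesis using that[of 1 x y] by simp
  next
    case False
    then have "M1 < 0" using \<open>M \<noteq> 0\<close> MN by (auto simp: not_less order_less_le)
    then have "N1 \<le> 0" using w1 by (metis zero_le_power2 zero_le_mult_iff not_less)
    obtain x where x: "- M1 = x\<^sup>2"
      using coprime_mult_square_int[of "- M1" "- N1" w1] MN(3) w1 \<open>M1 < 0\<close> by auto
    moreover obtain y where "- N1 = y\<^sup>2"
    proof (cases "N1 = 0")
      case False
      then show ?thesis
        using coprime_mult_square_int[of "- N1" "- M1" w1] MN(3) w1 \<open>N1 \<le> 0\<close> that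
        by (auto simp: coprime_commute mult.commute)
    qed (use that[of 0] in simp)
    ultimately show thesis using that[of "- 1" x y] by simp
  qed
  have no_square: False if d: "d = s\<^sup>2" for s
  proof (cases "e = 1")
    case True
    then have "a\<^sup>2 - b\<^sup>2 = (s * x)\<^sup>2" "a\<^sup>2 - (c\<^sup>2 + 1) * b\<^sup>2 = (s * y)\<^sup>2"
      using MN exy d unfolding M_def N_def by (simp_all add: power_mult_distrib)
    then show False using concordant_forms[OF c] \<open>b \<noteq> 0\<close> by blast
  next
    case False
    then have neg: "b\<^sup>2 - a\<^sup>2 = (s * x)\<^sup>2" "(c\<^sup>2 + 1) * b\<^sup>2 - a\<^sup>2 = (s * y)\<^sup>2"
      using MN exy d unfolding M_def N_def by (simp_all add: power_mult_distrib)
    \<comment> \<open>Translation by the 2-torsion point \<open>(1, 0)\<close> of \<open>y\<^sup>2 = x (x - 1) (x - c\<^sup>2 - 1)\<close>.\<close>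
    have "(s * y)\<^sup>2 - (s * x)\<^sup>2 = (c * b)\<^sup>2" "(s * y)\<^sup>2 - (c\<^sup>2 + 1) * (s * x)\<^sup>2 = (c * a)\<^sup>2"
      unfolding neg[symmetric] by (simp_all add: power_mult_distrib algebra_simps)
    then have "s * x = 0" using concordant_forms[OF c] by blast
    then show False using neg(1) neq unfolding \<open>s * x = 0\<close> by simp
  qed
  have "d \<noteq> 1" "d \<noteq> 4" "d \<noteq> 16" using no_square[of 1] no_square[of 2] no_square[of 4] by auto
  then have "d = 2 \<or> c = 4 \<and> d = 8" using d_cases by auto
  then have "even d" by auto
  \<comment> \<open>Here \<open>a\<close> and \<open>b\<close> are odd. For \<open>c = 2\<close>, 4
    divides both \<open>M\<close> and \<open>N\<close>, which is too much for \<open>d = 2\<close>.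
    For \<open>c = 4\<close>, 8 divides both, and \<open>d = 8\<close> makes a difference of two
    squares congruent to 2 modulo 4.\<close>
  have N: "N = M - c\<^sup>2 * b\<^sup>2" unfolding M_def N_def by (simp add: algebra_simps)
  show False
  proof (cases "c = 2")
    case True
    have "4 dvd M" using M8[OF \<open>even d\<close>] by (rule dvd_trans[rotated]) simp
    then have "4 dvd d" unfolding d_def N True by simp
    then show False using \<open>d = 2 \<or> c = 4 \<and> d = 8\<close> True by auto
  next
    case False
    then have "c = 4" using c by simp
    have "8 dvd d" using M8[OF \<open>even d\<close>] unfolding d_def N \<open>c = 4\<close> by (auto intro: dvd_diff dvd_mult2)
    then have "d = 8" using \<open>d = 2 \<or> c = 4 \<and> d = 8\<close> by auto
    then have "M1 - N1 = 2 * b\<^sup>2" using N MN \<open>c = 4\<close> by simp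
    then have "e * (x\<^sup>2 - y\<^sup>2) = 2 * b\<^sup>2" using exy by (simp add: algebra_simps)
    then have "(x\<^sup>2 - y\<^sup>2) mod 4 = 2"
      using exy(1) square_mod_4[of b] odd[OF \<open>even d\<close>] by auto presburger+
    then show False using square_mod_4[of x] square_mod_4[of y] by (auto split: if_splits) presburger+
  qed
qed

lemma rat_square_int:
  fixes q :: rat
  assumes "q\<^sup>2 = of_int m"
  obtains w where "q = of_int w"
proof -
  obtain a b where q: "q = of_int a / of_int b" "b > 0" "coprime a b"
    by (metis quotient_of_coprime quotient_of_denom_pos quotient_of_div surj_pair)
  then have "(of_int (a\<^sup>2) :: rat) = of_int (m * b\<^sup>2)"
    using assms by (auto simp: power_divide divide_eq_eq)
  then have "a\<^sup>2 = m * b\<^sup>2" by (simp only: of_int_eq_iff)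
  then have "b\<^sup>2 dvd a\<^sup>2" by simp
  then have "b dvd a" by (simp add: pow_divides_pow_iff)
  then obtain k where "a = b * k" by (rule dvdE)
  then show thesis using q that[of k] by simp
qed

text \<open>Multiplying by the fourth power of the denominator of \<open>q\<close> makes the left
  side an integer, so the scaled \<open>w\<close> is an integer too.\<close>

lemma quartic_rat_points:
  fixes q w :: rat and c :: int
  assumes c: "c = 2 \<or> c = 4" and w: "(q\<^sup>2 - 1) * (q\<^sup>2 - (of_int c ^ 2 + 1)) = w\<^sup>2"
  shows "q\<^sup>2 = 1"
proof -
  obtain a b where q: "q = of_int a / of_int b" "b > 0" "coprime a b"
    by (metis quotient_of_coprime quotient_of_denom_pos quotient_of_div surj_pair)
  have "(w * of_int b ^ 2)\<^sup>2 = ((q\<^sup>2 - 1) * of_int b ^ 2) * ((q\<^sup>2 - (of_int c ^ 2 + 1)) * of_int b ^ 2)"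
    unfolding power_mult_distrib w[symmetric] by (simp add: power2_eq_square algebra_simps)
  also have "(q\<^sup>2 - 1) * of_int b ^ 2 = of_int (a\<^sup>2 - b\<^sup>2)"
    using q(1,2) by (simp add: power_divide left_diff_distrib)
  also have "(q\<^sup>2 - (of_int c ^ 2 + 1)) * of_int b ^ 2 = of_int (a\<^sup>2 - (c\<^sup>2 + 1) * b\<^sup>2)"
    using q(1,2) by (simp add: power_divide left_diff_distrib)
  finally have *: "(w * of_int b ^ 2)\<^sup>2 = of_int ((a\<^sup>2 - b\<^sup>2) * (a\<^sup>2 - (c\<^sup>2 + 1) * b\<^sup>2))"
    by simp
  then obtain w' where "w * of_int b ^ 2 = of_int w'" by (rule rat_square_int)
  then have "(a\<^sup>2 - b\<^sup>2) * (a\<^sup>2 - (c\<^sup>2 + 1) * b\<^sup>2) = w'\<^sup>2"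
    using * by (metis of_int_eq_iff of_int_power)
  then have "a\<^sup>2 = b\<^sup>2" using quartic_int_points[OF c q(3)] q(2) by simp
  then show ?thesis using q(1,2) by (metis div_self of_int_eq_0_iff of_int_power power_divide power_not_zero less_irrefl)
qed

text \<open>This is the elliptic curve with \<open>\<alpha> = g\<close> and
  \<open>\<beta> = - f\<close>. For \<open>q = w / (f * g)\<close>, \<open>q^2\<close> is the
  coordinate \<open>p\<close> of the image under the 2-isogeny. Both \<open>q^2 - 1\<close> and
  \<open>q^2 - (4 * e + 1)\<close> are \<open>- 1 / (f * g)\<close> times a square, so their product
  is a square and \<open>quartic_rat_points\<close> applies.\<close>

lemma pencil_rat_points:
  fixes f g w :: rat and e :: int
  assumes e: "e = 1 \<or> e = 4" and "f \<noteq> 0" "g \<noteq> 0"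
    and w: "- (f * g * (g\<^sup>2 - (2 * of_int e + 1) * f * g + of_int e ^ 2 * f\<^sup>2)) = w\<^sup>2"
  shows "g = of_int e * f"
proof -
  \<comment> \<open>Chosen so that \<open>c^2 = 4 * e\<close>.\<close>
  define c :: int where "c = (if e = 1 then 2 else 4)"
  define E :: rat where "E = of_int e"
  have c: "c = 2 \<or> c = 4" unfolding c_def by simp
  have cE: "(of_int c :: rat)\<^sup>2 = 4 * E" using e unfolding c_def E_def by auto
  define q where "q = w / (f * g)"
  have q2: "q\<^sup>2 * (f * g) = - (g\<^sup>2 - (2 * E + 1) * f * g + E ^ 2 * f\<^sup>2)"
    using assms(2,3) w unfolding q_def E_def by (simp add: power_divide field_simps power2_eq_square)
  have 1: "(q\<^sup>2 - 1) * (f * g) = - ((g - E * f)\<^sup>2)"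
    using q2 by (simp add: algebra_simps power2_eq_square)
  have 2: "(q\<^sup>2 - (4 * E + 1)) * (f * g) = - ((g + E * f)\<^sup>2)"
    using q2 by (simp add: algebra_simps power2_eq_square)
  have "(q\<^sup>2 - 1) * (q\<^sup>2 - (4 * E + 1)) = ((g - E * f) * (g + E * f) / (f * g))\<^sup>2"
  proof -
    have "((q\<^sup>2 - 1) * (q\<^sup>2 - (4 * E + 1))) * (f * g)\<^sup>2
        = ((q\<^sup>2 - 1) * (f * g)) * ((q\<^sup>2 - (4 * E + 1)) * (f * g))"
      by (simp add: power2_eq_square mult_ac)
    also have "\<dots> = ((g - E * f) * (g + E * f))\<^sup>2"
      unfolding 1 2 by (simp add: power_mult_distrib)
    finally show ?thesis using assms(2,3) by (simp add: power_divide field_simps)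
  qed
  then have "q\<^sup>2 = 1" using quartic_rat_points[OF c] cE by metis
  then show ?thesis using 1 unfolding E_def by simp
qed

section \<open>Rational values of \<open>t\<close> and rational lines on the quadrics\<close>

text \<open>The composite values \<open>10 = 2 * 5\<close> and \<open>85 = 5 * 17\<close> serve to
  show that no quadratic field contains square roots of both 2 and 5, or of both 5 and 17.\<close>

lemma rat_square_neq:
  fixes q :: rat
  assumes "n \<in> {2, 5, 10, 17, 85}"
  shows "q\<^sup>2 \<noteq> of_int n"
proof
  assume q: "q\<^sup>2 = of_int n"
  then obtain w where "q = of_int w" by (rule rat_square_int)
  define m where "m = \<bar>w\<bar>"
  have m: "m\<^sup>2 = n" using q \<open>q = of_int w\<close> unfolding m_def by (simp flip: of_int_power)
  then have "m\<^sup>2 < 10\<^sup>2" using assms by auto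
  then have "m < 10" by (rule power2_less_imp_less) simp
  then have "m \<in> set [0..9]" unfolding m_def by auto
  then show False using m assms by (auto simp: upto_rec1)
qed

lemma quadratic_pos_rat:
  fixes t :: rat
  shows "t\<^sup>2 + 4 > 0" "2 * t\<^sup>2 + 4 * t + 4 > 0" "5 * t\<^sup>2 + 8 * t + 16 > 0"
proof -
  show "t\<^sup>2 + 4 > 0" by (rule add_nonneg_pos) auto
  have "2 * t\<^sup>2 + 4 * t + 4 = 2 * ((t + 1)\<^sup>2 + 1)" by (simp add: power2_eq_square algebra_simps)
  also have "\<dots> > 0" by (simp add: add_nonneg_pos)
  finally show "2 * t\<^sup>2 + 4 * t + 4 > 0" .
  have "5 * t\<^sup>2 + 8 * t + 16 = 4 * t\<^sup>2 + (t + 4)\<^sup>2" by (simp add: power2_eq_square algebra_simps)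
  also have "\<dots> > 0"
  proof (cases "t = 0")
    case False
    then show ?thesis by (intro add_pos_nonneg) auto
  qed auto
  finally show "5 * t\<^sup>2 + 8 * t + 16 > 0" .
qed

text \<open>For \<open>f = q\<^sub>1(t)\<close> and \<open>g = q\<^sub>2(t)\<close> the form \<open>g q\<^sub>1 - f q\<^sub>2\<close> vanishes at \<open>t\<close>, so its discriminant is a square.\<close>

lemma quartic_AY:
  fixes t w :: rat
  assumes "w\<^sup>2 = (t\<^sup>2 + 4) * (2 * t\<^sup>2 + 4 * t + 4)"
  shows "t = 0 \<or> t = - 4"
proof -
  define f g where "f = t\<^sup>2 + 4" and "g = 2 * t\<^sup>2 + 4 * t + 4"
  have "f \<noteq> 0" "g \<noteq> 0" using quadratic_pos_rat[of t] unfolding f_def g_def by simp_all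
  \<comment> \<open>A quarter of the discriminant of the form with coefficients
    \<open>g - 2 * f\<close>, \<open>- 4 * f\<close>, \<open>4 * g - 4 * f\<close>, as the square of
    half its derivative at the root \<open>t\<close>.\<close>
  have disc: "- (4 * (g\<^sup>2 - 3 * f * g + f\<^sup>2)) = ((g - 2 * f) * t - 2 * f)\<^sup>2"
    unfolding f_def g_def by (simp add: power2_eq_square algebra_simps)
  have "- (f * g * (g\<^sup>2 - (2 * of_int 1 + 1) * f * g + of_int 1 ^ 2 * f\<^sup>2))
      = f * g * (- (4 * (g\<^sup>2 - 3 * f * g + f\<^sup>2))) / 4"
    by (simp add: field_simps)
  also have "\<dots> = (w * ((g - 2 * f) * t - 2 * f) / 2)\<^sup>2"
    unfolding disc using assms unfolding f_def[symmetric] g_def[symmetric]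
    by (simp add: power_mult_distrib power_divide)
  finally have "g = of_int 1 * f" using \<open>f \<noteq> 0\<close> \<open>g \<noteq> 0\<close> pencil_rat_points by blast
  then have "t * (t + 4) = 0" unfolding f_def g_def by (simp add: algebra_simps power2_eq_square)
  then show ?thesis by (auto simp: add_eq_0_iff2)
qed

text \<open>This pencil, like that of \<open>Y\<close> and \<open>Z\<close>, belongs to
  \<open>e = 4\<close>, whereas \<open>A\<close> and \<open>Y\<close> lead to
  \<open>e = 1\<close>.\<close>

lemma quartic_AZ:
  fixes t w :: rat
  assumes "w\<^sup>2 = (t\<^sup>2 + 4) * (5 * t\<^sup>2 + 8 * t + 16)"
  shows "t = 0 \<or> t = - 8"
proof -
  define f g where "f = t\<^sup>2 + 4" and "g = 5 * t\<^sup>2 + 8 * t + 16"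
  have "f \<noteq> 0" "g \<noteq> 0" using quadratic_pos_rat[of t] unfolding f_def g_def by simp_all
  have disc: "- (4 * (g\<^sup>2 - 9 * f * g + 16 * f\<^sup>2)) = ((g - 5 * f) * t - 4 * f)\<^sup>2"
    unfolding f_def g_def by (simp add: power2_eq_square algebra_simps)
  have "- (f * g * (g\<^sup>2 - (2 * of_int 4 + 1) * f * g + of_int 4 ^ 2 * f\<^sup>2))
      = f * g * (- (4 * (g\<^sup>2 - 9 * f * g + 16 * f\<^sup>2))) / 4"
    by (simp add: field_simps)
  also have "\<dots> = (w * ((g - 5 * f) * t - 4 * f) / 2)\<^sup>2"
    unfolding disc using assms unfolding f_def[symmetric] g_def[symmetric]
    by (simp add: power_mult_distrib power_divide)
  finally have "g = of_int 4 * f" using \<open>f \<noteq> 0\<close> \<open>g \<noteq> 0\<close> pencil_rat_points by blast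
  then have "t * (t + 8) = 0" unfolding f_def g_def by (simp add: algebra_simps power2_eq_square)
  then show ?thesis by (auto simp: add_eq_0_iff2)
qed

lemma quartic_YZ:
  fixes t w :: rat
  assumes "w\<^sup>2 = (2 * t\<^sup>2 + 4 * t + 4) * (5 * t\<^sup>2 + 8 * t + 16)"
  shows "t = 0 \<or> t = - 8 / 3"
proof -
  define f g where "f = 2 * t\<^sup>2 + 4 * t + 4" and "g = 5 * t\<^sup>2 + 8 * t + 16"
  have "f \<noteq> 0" "g \<noteq> 0" using quadratic_pos_rat[of t] unfolding f_def g_def by simp_all
  have disc: "- (4 * (g\<^sup>2 - 9 * f * g + 16 * f\<^sup>2)) = ((2 * g - 5 * f) * t + (2 * g - 4 * f))\<^sup>2"
    unfolding f_def g_def by (simp add: power2_eq_square algebra_simps)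
  have "- (f * g * (g\<^sup>2 - (2 * of_int 4 + 1) * f * g + of_int 4 ^ 2 * f\<^sup>2))
      = f * g * (- (4 * (g\<^sup>2 - 9 * f * g + 16 * f\<^sup>2))) / 4"
    by (simp add: field_simps)
  also have "\<dots> = (w * ((2 * g - 5 * f) * t + (2 * g - 4 * f)) / 2)\<^sup>2"
    unfolding disc using assms unfolding f_def[symmetric] g_def[symmetric]
    by (simp add: power_mult_distrib power_divide)
  finally have "g = of_int 4 * f" using \<open>f \<noteq> 0\<close> \<open>g \<noteq> 0\<close> pencil_rat_points by blast
  then have "t * (3 * t + 8) = 0" unfolding f_def g_def by (simp add: algebra_simps power2_eq_square)
  then have "t = 0 \<or> 3 * t + 8 = 0" by simp
  then show ?thesis by auto
qed

text \<open>\<open>A = a t + b\<close>, \<open>Y = c t + e\<close> and \<open>Z = i t + j\<close> with \<open>t\<^sup>2 = m t + k\<close>. A member of a pencil of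
  quadrics that vanishes on this line has square discriminant.\<close>

lemma no_rational_line:
  fixes a b c e i j m k :: rat
  assumes A: "(a\<^sup>2 - 1) * m + 2 * a * b = 0" "(a\<^sup>2 - 1) * k + b\<^sup>2 - 4 = 0"
    and Y: "(c\<^sup>2 - 2) * m + 2 * c * e - 4 = 0" "(c\<^sup>2 - 2) * k + e\<^sup>2 - 4 = 0"
    and Z: "(i\<^sup>2 - 5) * m + 2 * i * j - 8 = 0" "(i\<^sup>2 - 5) * k + j\<^sup>2 - 16 = 0"
  shows "m = 0 \<and> k = 0"
proof -
  \<comment> \<open>By the hypotheses, the three quadrics restrict on the line to \<open>f\<close>,
    \<open>g\<close> and \<open>h\<close> times \<open>t^2 - m * t - k\<close>.\<close>
  define f g h where "f = a\<^sup>2 - 1" and "g = c\<^sup>2 - 2" and "h = i\<^sup>2 - 5"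
  note defs = f_def g_def h_def
  have A': "b\<^sup>2 = 4 - f * k" "a * b = - (f * m / 2)"
    and Y': "e\<^sup>2 = 4 - g * k" "c * e = 2 - g * m / 2"
    and Z': "j\<^sup>2 = 16 - h * k" "i * j = 4 - h * m / 2"
    using A Y Z unfolding defs[symmetric] by (simp_all add: algebra_simps)
  have "f \<noteq> 0"
  proof
    assume "f = 0"
    then have "a \<noteq> 0" unfolding f_def by auto
    then have "b = 0" using A(1) \<open>f = 0\<close> unfolding f_def by simp
    then show False using A(2) \<open>f = 0\<close> unfolding f_def by simp
  qed
  have "g \<noteq> 0" using rat_square_neq[of 2 c] unfolding g_def by simp
  have "h \<noteq> 0" using rat_square_neq[of 5 i] unfolding h_def by simp
  have "- (f * g * (g\<^sup>2 - (2 * of_int 1 + 1) * f * g + of_int 1 ^ 2 * f\<^sup>2)) = (f * g * (a * e - b * c) / 2)\<^sup>2"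
  proof -
    \<comment> \<open>Consequently \<open>g * (a * t + b)^2 - f * (c * t + e)^2\<close> and
      \<open>g * (t^2 + 4) - f * (2 * t^2 + 4 * t + 4)\<close> are the same polynomial in
      \<open>t\<close>. The three facts compare coefficients; the determinant of the first
      expression is \<open>- f * g * (a * e - b * c)^2\<close>.\<close>
    have 1: "g * a\<^sup>2 - f * c\<^sup>2 = g - 2 * f" unfolding defs by (simp add: algebra_simps)
    have 2: "g * b\<^sup>2 - f * e\<^sup>2 = 4 * g - 4 * f" unfolding A' Y' by (simp add: algebra_simps)
    have 3: "g * (a * b) - f * (c * e) = - 2 * f" unfolding A' Y' by (simp add: algebra_simps)
    have "4 * (g\<^sup>2 - 3 * f * g + f\<^sup>2) = (g - 2 * f) * (4 * g - 4 * f) - (- 2 * f)\<^sup>2"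
      by (simp add: power2_eq_square algebra_simps)
    also have "\<dots> = - (f * g * (a * e - b * c)\<^sup>2)"
      unfolding 1[symmetric] 2[symmetric] 3[symmetric] by (simp add: power2_eq_square algebra_simps)
    finally have *: "4 * (g\<^sup>2 - 3 * f * g + f\<^sup>2) = - (f * g * (a * e - b * c)\<^sup>2)" .
    have "- (f * g * (4 * (g\<^sup>2 - 3 * f * g + f\<^sup>2))) = (f * g * (a * e - b * c))\<^sup>2"
      unfolding * by (simp add: power2_eq_square)
    then show ?thesis by (simp add: power_divide field_simps)
  qed
  then have gf: "g = f" using pencil_rat_points[of 1 f g] \<open>f \<noteq> 0\<close> \<open>g \<noteq> 0\<close> by simp
  have "- (f * h * (h\<^sup>2 - (2 * of_int 4 + 1) * f * h + of_int 4 ^ 2 * f\<^sup>2)) = (f * h * (a * j - b * i) / 2)\<^sup>2"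
  proof -
    have 1: "h * a\<^sup>2 - f * i\<^sup>2 = h - 5 * f" unfolding defs by (simp add: algebra_simps)
    have 2: "h * b\<^sup>2 - f * j\<^sup>2 = 4 * h - 16 * f" unfolding A' Z' by (simp add: algebra_simps)
    have 3: "h * (a * b) - f * (i * j) = - 4 * f" unfolding A' Z' by (simp add: algebra_simps)
    have "4 * (h\<^sup>2 - 9 * f * h + 16 * f\<^sup>2) = (h - 5 * f) * (4 * h - 16 * f) - (- 4 * f)\<^sup>2"
      by (simp add: power2_eq_square algebra_simps)
    also have "\<dots> = - (f * h * (a * j - b * i)\<^sup>2)"
      unfolding 1[symmetric] 2[symmetric] 3[symmetric] by (simp add: power2_eq_square algebra_simps)
    finally have *: "4 * (h\<^sup>2 - 9 * f * h + 16 * f\<^sup>2) = - (f * h * (a * j - b * i)\<^sup>2)" .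
    have "- (f * h * (4 * (h\<^sup>2 - 9 * f * h + 16 * f\<^sup>2))) = (f * h * (a * j - b * i))\<^sup>2"
      unfolding * by (simp add: power2_eq_square)
    then show ?thesis by (simp add: power_divide field_simps)
  qed
  then have hf: "h = 4 * f" using pencil_rat_points[of 4 f h] \<open>f \<noteq> 0\<close> \<open>h \<noteq> 0\<close> by simp
  have eqs: "c\<^sup>2 = a\<^sup>2 + 1" "e\<^sup>2 = b\<^sup>2" "c * e = a * b + 2"
    "i\<^sup>2 = 4 * a\<^sup>2 + 1" "j\<^sup>2 = 4 * b\<^sup>2" "i * j = 4 * (a * b) + 4"
  proof -
    show "c\<^sup>2 = a\<^sup>2 + 1" "i\<^sup>2 = 4 * a\<^sup>2 + 1" using gf hf unfolding defs by (simp_all add: algebra_simps)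
    show "e\<^sup>2 = b\<^sup>2" "c * e = a * b + 2" "j\<^sup>2 = 4 * b\<^sup>2" "i * j = 4 * (a * b) + 4"
      unfolding A' Y' Z' gf hf by (simp_all add: algebra_simps)
  qed
  \<comment> \<open>Computing \<open>(c * e)^2\<close> and \<open>(i * j)^2\<close> in two ways
    gives two formulas for \<open>b^2\<close>, which agree only when
    \<open>a * b = 0\<close>.\<close>
  have "(c * e)\<^sup>2 = (a\<^sup>2 + 1) * b\<^sup>2" unfolding power_mult_distrib eqs(1,2) ..
  then have 1: "b\<^sup>2 = 4 * (a * b) + 4" unfolding eqs(3) by (simp add: power2_eq_square algebra_simps)
  have "(i * j)\<^sup>2 = (4 * a\<^sup>2 + 1) * (4 * b\<^sup>2)" unfolding power_mult_distrib eqs(4,5) ..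
  then have 2: "b\<^sup>2 = 8 * (a * b) + 4" unfolding eqs(6) by (simp add: power2_eq_square algebra_simps)
  have "a * b = 0" using 1 2 by simp
  moreover from this have "b\<^sup>2 = 4" using 1 by simp
  ultimately have "a = 0" "b\<^sup>2 = 4" by auto
  then show ?thesis using A by simp
qed

section \<open>Arithmetic of rational combinations of 1 and \<open>s\<close>\<close>

text \<open>For \<open>s^2 \<in> \<rat>\<close> this is the field generated by \<open>s\<close>, in
  coordinates suited to comparing coefficients. A rational \<open>s\<close> is permitted and gives
  \<rat>, so one argument covers rational and quadratic points.\<close>

definition quad_ext :: "'a::field_char_0 \<Rightarrow> 'a set" where
  "quad_ext s = {of_rat p + of_rat q * s | p q. True}"

lemma quad_extI: "of_rat p + of_rat q * s \<in> quad_ext s"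
  unfolding quad_ext_def by blast

lemma quad_extE:
  assumes "x \<in> quad_ext s"
  obtains p q where "x = of_rat p + of_rat q * s"
  using assms unfolding quad_ext_def by blast

lemma Rats_subset_quad_ext: "\<rat> \<subseteq> quad_ext s"
  using quad_extI[of _ 0 s] by (auto elim!: Rats_cases)

lemma quad_ext_self: "s \<in> quad_ext s"
  using quad_extI[of 0 1 s] by simp

lemma quad_ext_rational: "s \<in> \<rat> \<Longrightarrow> quad_ext s = \<rat>"
  using Rats_subset_quad_ext[of s] by (auto elim!: quad_extE)

lemma quad_ext_add:
  assumes "x \<in> quad_ext s" "y \<in> quad_ext s"
  shows "x + y \<in> quad_ext s"
proof -
  obtain p q p' q' where "x = of_rat p + of_rat q * s" "y = of_rat p' + of_rat q' * s"
    using assms by (elim quad_extE)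
  then have "x + y = of_rat (p + p') + of_rat (q + q') * s"
    by (simp add: of_rat_add algebra_simps)
  then show ?thesis by (simp only: quad_extI)
qed

lemma quad_ext_minus:
  assumes "x \<in> quad_ext s"
  shows "- x \<in> quad_ext s"
proof -
  obtain p q where "x = of_rat p + of_rat q * s"
    using assms by (elim quad_extE)
  then have "- x = of_rat (- p) + of_rat (- q) * s"
    by (simp add: of_rat_minus)
  then show ?thesis by (simp only: quad_extI)
qed

lemma quad_ext_diff: "x \<in> quad_ext s \<Longrightarrow> y \<in> quad_ext s \<Longrightarrow> x - y \<in> quad_ext s"
  using quad_ext_add[OF _ quad_ext_minus] by fastforce

lemma quad_ext_mult:
  assumes "s\<^sup>2 \<in> \<rat>" "x \<in> quad_ext s" "y \<in> quad_ext s"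
  shows "x * y \<in> quad_ext s"
proof -
  obtain d where d: "s * s = of_rat d" using assms(1) by (auto elim: Rats_cases simp: power2_eq_square)
  obtain p q p' q' where "x = of_rat p + of_rat q * s" "y = of_rat p' + of_rat q' * s"
    using assms(2,3) by (elim quad_extE)
  then have "x * y = of_rat (p * p') + of_rat q * of_rat q' * (s * s) + of_rat (p * q' + q * p') * s"
    by (simp add: of_rat_mult of_rat_add algebra_simps)
  also have "\<dots> = of_rat (p * p' + q * q' * d) + of_rat (p * q' + q * p') * s"
    unfolding d by (simp add: of_rat_mult of_rat_add)
  finally show ?thesis by (simp only: quad_extI)
qed

lemma linear_independent_Rats:
  assumes "s \<notin> \<rat>" "of_rat p + of_rat q * s = 0"
  shows "p = 0" "q = 0"
proof -
  show "q = 0"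
  proof (rule ccontr)
    assume "q \<noteq> 0"
    have "of_rat q * s = of_rat (- p)" using assms(2) by (simp add: eq_neg_iff_add_eq_0 add.commute of_rat_minus)
    then have "s = of_rat (- p) / of_rat q" using \<open>q \<noteq> 0\<close> by (simp add: field_simps)
    then have "s = of_rat (- p / q)" by (simp only: of_rat_divide)
    then show False using assms(1) by simp
  qed
  then show "p = 0" using assms(2) by simp
qed

text \<open>An irrational \<open>p + q * s\<close> has \<open>q \<noteq> 0\<close>, so it can be
  solved for \<open>s\<close>. Any irrational element, such as a parameter or a coordinate of a
  point, may thus serve as generator.\<close>

lemma quad_ext_eqI:
  assumes "r \<in> quad_ext s" "r \<notin> \<rat>"
  shows "quad_ext s = quad_ext r"
proof -
  obtain p q where r: "r = of_rat p + of_rat q * s" using assms(1) by (rule quad_extE)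
  have "q \<noteq> 0" using assms(2) r by auto
  then have Q: "(of_rat q :: 'a) \<noteq> 0" by simp
  have "of_rat a + of_rat b * s = of_rat (a - b * p / q) + of_rat (b / q) * r" for a b
    unfolding r of_rat_diff of_rat_mult of_rat_divide using Q by (simp add: field_simps)
  moreover have "of_rat a + of_rat b * r = of_rat (a + b * p) + of_rat (b * q) * s" for a b
    unfolding r by (simp add: of_rat_mult of_rat_add algebra_simps)
  ultimately show ?thesis
    by (intro equalityI subsetI; elim quad_extE) (metis quad_extI)+
qed

text \<open>For irrational \<open>s\<close>, the coefficient of \<open>s\<close> in
  \<open>(p + q * s)^2\<close> is \<open>2 * p * q\<close>, which must vanish.\<close>

lemma rational_square_cases:
  assumes "s\<^sup>2 \<in> \<rat>" "u \<in> quad_ext s" "u\<^sup>2 \<in> \<rat>"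
  shows "\<exists>r. u = of_rat r \<or> u = of_rat r * s"
proof (cases "s \<in> \<rat>")
  case True
  then have "u \<in> \<rat>" using assms(2) quad_ext_rational by blast
  then show ?thesis by (auto elim: Rats_cases)
next
  case False
  obtain d where d: "s\<^sup>2 = of_rat d" using assms(1) by (auto elim: Rats_cases)
  obtain e where e: "u\<^sup>2 = of_rat e" using assms(3) by (auto elim: Rats_cases)
  obtain p q where u: "u = of_rat p + of_rat q * s" using assms(2) by (rule quad_extE)
  have "of_rat (p * p + q * q * d - e) + of_rat (2 * p * q) * s = u\<^sup>2 - of_rat e"
    unfolding u by (simp add: of_rat_mult of_rat_add of_rat_diff power2_eq_square algebra_simps flip: d)
  also have "\<dots> = 0" using e by simp
  finally have "2 * p * q = 0" by (rule linear_independent_Rats(2)[OF False])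
  then show ?thesis using u by auto
qed

text \<open>By \<open>rational_square_cases\<close>, \<open>r\<close> is rational or a rational
  multiple of \<open>s\<close>; accordingly \<open>m\<close> or \<open>m * n\<close> would be a
  rational square.\<close>

lemma no_simultaneous_square_roots:
  fixes r s :: "'a::field_char_0"
  assumes "r \<in> quad_ext s" "r\<^sup>2 = of_int m" "s\<^sup>2 = of_int n"
    and "\<And>q :: rat. q\<^sup>2 \<noteq> of_int m" "\<And>q :: rat. q\<^sup>2 \<noteq> of_int (m * n)"
  shows False
proof -
  obtain q where "r = of_rat q \<or> r = of_rat q * s"
    using rational_square_cases[of s r] assms(1-3) by auto
  then show False
  proof
    assume "r = of_rat q"
    then have "(of_rat (q\<^sup>2) :: 'a) = of_rat (of_int m)" using assms(2) by (simp add: of_rat_power)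
    then show False using assms(4) by (simp only: of_rat_eq_iff)
  next
    assume "r = of_rat q * s"
    then have "(of_rat ((q * of_int n)\<^sup>2) :: 'a) = r\<^sup>2 * s\<^sup>2"
      using assms(3) by (simp add: of_rat_power of_rat_mult power_mult_distrib power2_eq_square)
    also have "\<dots> = of_rat (of_int (m * n))" unfolding assms(2,3) of_rat_of_int_eq by simp
    finally show False using assms(5) by (simp only: of_rat_eq_iff)
  qed
qed

lemma irrational_sqrt:
  fixes s :: "'a::field_char_0"
  assumes "s\<^sup>2 = of_int n" "\<And>q :: rat. q\<^sup>2 \<noteq> of_int n"
  shows "s \<notin> \<rat>"
proof
  assume "s \<in> \<rat>"
  then obtain q where "s = of_rat q" by (rule Rats_cases)
  then have "(of_rat (q\<^sup>2) :: 'a) = of_rat (of_int n)" using assms(1) by (simp add: of_rat_power)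
  then show False using assms(2) by (simp only: of_rat_eq_iff)
qed

section \<open>The three quadrics over a quadratic field\<close>

text \<open>An irrational \<open>t\<close> would generate the field, making \<open>A\<close>,
  \<open>Y\<close>, \<open>Z\<close> rational linear functions of \<open>t\<close>. Comparing
  coefficients gives the equations of \<open>no_rational_line\<close>, which leave only
  \<open>t = 0\<close>.\<close>

lemma rational_parameter:
  fixes s t A Y Z :: "'a::field_char_0"
  assumes s: "s\<^sup>2 \<in> \<rat>" and mem: "t \<in> quad_ext s" "A \<in> quad_ext s" "Y \<in> quad_ext s" "Z \<in> quad_ext s"
    and A: "A\<^sup>2 = t\<^sup>2 + 4" and Y: "Y\<^sup>2 = 2 * t\<^sup>2 + 4 * t + 4" and Z: "Z\<^sup>2 = 5 * t\<^sup>2 + 8 * t + 16"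
  shows "t \<in> \<rat>"
proof (rule ccontr)
  assume t: "t \<notin> \<rat>"
  have st: "quad_ext s = quad_ext t" using quad_ext_eqI mem(1) t by metis
  have "t\<^sup>2 \<in> quad_ext s" using quad_ext_mult[OF s mem(1,1)] by (simp add: power2_eq_square)
  then obtain k m where t2: "t\<^sup>2 = of_rat k + of_rat m * t" unfolding st by (rule quad_extE)
  obtain b a where a: "A = of_rat b + of_rat a * t" using mem(2) unfolding st by (rule quad_extE)
  obtain e c where c: "Y = of_rat e + of_rat c * t" using mem(3) unfolding st by (rule quad_extE)
  obtain j i where i: "Z = of_rat j + of_rat i * t" using mem(4) unfolding st by (rule quad_extE)
  \<comment> \<open>Coordinates of the difference of the two sides with respect to 1 and
    \<open>t\<close>, after replacing \<open>t^2\<close> by \<open>k + m * t\<close>.\<close>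
  have expand: "of_rat ((a\<^sup>2 - l) * k + b\<^sup>2 - n) + of_rat ((a\<^sup>2 - l) * m + 2 * a * b - r) * t = 0"
    if "(of_rat b + of_rat a * t)\<^sup>2 = of_rat l * t\<^sup>2 + of_rat r * t + of_rat n" for a b l n r
  proof -
    have "of_rat ((a\<^sup>2 - l) * k + b\<^sup>2 - n) + of_rat ((a\<^sup>2 - l) * m + 2 * a * b - r) * t
      = (of_rat (a\<^sup>2) - of_rat l) * (of_rat k + of_rat m * t) + of_rat (2 * a * b) * t + of_rat (b\<^sup>2)
        - of_rat r * t - of_rat n"
      by (simp add: of_rat_add of_rat_diff of_rat_mult algebra_simps)
    also have "\<dots> = (of_rat b + of_rat a * t)\<^sup>2 - (of_rat l * t\<^sup>2 + of_rat r * t + of_rat n)"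
      unfolding t2[symmetric] by (simp add: of_rat_mult power2_eq_square algebra_simps)
    finally show ?thesis using that by simp
  qed
  have "A\<^sup>2 = of_rat 1 * t\<^sup>2 + of_rat 0 * t + of_rat 4"
    "Y\<^sup>2 = of_rat 2 * t\<^sup>2 + of_rat 4 * t + of_rat 4"
    "Z\<^sup>2 = of_rat 5 * t\<^sup>2 + of_rat 8 * t + of_rat 16"
    using A Y Z by simp_all
  note eqs = this[unfolded a c i, THEN expand, THEN linear_independent_Rats(1)[OF t]]
    this[unfolded a c i, THEN expand, THEN linear_independent_Rats(2)[OF t]]
  have "m = 0 \<and> k = 0"
    by (rule no_rational_line[of a m b k c e i j]) (use eqs in simp_all)
  then have "t = 0" using t2 by simp
  then show False using t by simp
qed

lemma rational_parameter_cases: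
  fixes s t A Y Z :: "'a::field_char_0"
  assumes s: "s\<^sup>2 \<in> \<rat>" and mem: "t \<in> quad_ext s" "A \<in> quad_ext s" "Y \<in> quad_ext s" "Z \<in> quad_ext s"
    and A: "A\<^sup>2 = t\<^sup>2 + 4" and Y: "Y\<^sup>2 = 2 * t\<^sup>2 + 4 * t + 4" and Z: "Z\<^sup>2 = 5 * t\<^sup>2 + 8 * t + 16"
  shows "t = 0 \<or> t = - 4 \<or> t = - 8 \<or> 3 * t = - 8"
proof -
  obtain d where d: "s\<^sup>2 = of_rat d" using s by (auto elim: Rats_cases)
  obtain T where T: "t = of_rat T" using rational_parameter[OF assms] by (auto elim: Rats_cases)
  have "A\<^sup>2 \<in> \<rat>" "Y\<^sup>2 \<in> \<rat>" "Z\<^sup>2 \<in> \<rat>" unfolding A Y Z T by simp_all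
  then have "\<exists>a. A = of_rat a \<or> A = of_rat a * s" "\<exists>a. Y = of_rat a \<or> Y = of_rat a * s"
    "\<exists>a. Z = of_rat a \<or> Z = of_rat a * s"
    using rational_square_cases[OF s] mem by blast+
  then obtain a y z where cases: "A = of_rat a \<or> A = of_rat a * s" "Y = of_rat y \<or> Y = of_rat y * s"
    "Z = of_rat z \<or> Z = of_rat z * s"
    by blast
  have prod: "\<exists>w. U * V = of_rat w" if "U = of_rat u \<and> V = of_rat v \<or> U = of_rat u * s \<and> V = of_rat v * s"
    for U V :: 'a and u v
  proof -
    have "U * V = of_rat (u * v) \<or> U * V = of_rat (u * v * d)"
      using that d by (auto simp: of_rat_mult power2_eq_square algebra_simps)
    then show ?thesis by blast
  qed
  \<comment> \<open>Pigeonhole: among three numbers, each rational or a rational multiple of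
    \<open>s\<close>, two are of the same kind, and their product is rational.\<close>
  have "(\<exists>w. A * Y = of_rat w) \<or> (\<exists>w. A * Z = of_rat w) \<or> (\<exists>w. Y * Z = of_rat w)"
    using cases prod[of A a Y y] prod[of A a Z z] prod[of Y y Z z] by blast
  then have "T = 0 \<or> T = - 4 \<or> T = - 8 \<or> 3 * T = - 8"
  proof (elim disjE exE)
    fix w assume w: "A * Y = of_rat w"
    have "(of_rat (w\<^sup>2) :: 'a) = (A * Y)\<^sup>2" unfolding w by (simp add: of_rat_power)
    also have "\<dots> = of_rat ((T\<^sup>2 + 4) * (2 * T\<^sup>2 + 4 * T + 4))"
      unfolding power_mult_distrib A Y T by (simp add: of_rat_add of_rat_mult of_rat_power)
    finally show ?thesis using quartic_AY[of w T] unfolding of_rat_eq_iff by auto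
  next
    fix w assume w: "A * Z = of_rat w"
    have "(of_rat (w\<^sup>2) :: 'a) = (A * Z)\<^sup>2" unfolding w by (simp add: of_rat_power)
    also have "\<dots> = of_rat ((T\<^sup>2 + 4) * (5 * T\<^sup>2 + 8 * T + 16))"
      unfolding power_mult_distrib A Z T by (simp add: of_rat_add of_rat_mult of_rat_power)
    finally show ?thesis using quartic_AZ[of w T] unfolding of_rat_eq_iff by auto
  next
    fix w assume w: "Y * Z = of_rat w"
    have "(of_rat (w\<^sup>2) :: 'a) = (Y * Z)\<^sup>2" unfolding w by (simp add: of_rat_power)
    also have "\<dots> = of_rat ((2 * T\<^sup>2 + 4 * T + 4) * (5 * T\<^sup>2 + 8 * T + 16))"
      unfolding power_mult_distrib Y Z T by (simp add: of_rat_add of_rat_mult of_rat_power)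
    finally show ?thesis using quartic_YZ[of w T] unfolding of_rat_eq_iff by auto
  qed
  moreover have "3 * t = - 8" if "3 * T = - 8"
  proof -
    have "(of_rat (3 * T) :: 'a) = - 8" unfolding that by (simp add: of_rat_minus)
    then show ?thesis unfolding T by (simp add: of_rat_mult)
  qed
  ultimately show ?thesis unfolding T by (auto simp: of_rat_minus)
qed

section \<open>Identification of quadratic fields and \<open>rat_adjoin s\<close> with
  \<open>quad_ext s\<close>\<close>

lemma quad_ext_inverse:
  assumes "s\<^sup>2 \<in> \<rat>" "x \<in> quad_ext s"
  shows "inverse x \<in> quad_ext s"
proof (cases "s \<in> \<rat> \<or> x = 0")
  \<comment> \<open>The case \<open>x = 0\<close> relies on the convention
    \<open>inverse 0 = 0\<close>.\<close>
  case True
  then show ?thesis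
  proof
    assume "s \<in> \<rat>"
    then have "quad_ext s = \<rat>" by (rule quad_ext_rational)
    then show ?thesis using assms(2) by simp
  qed (use assms(2) in simp)
next
  case False
  then have "s \<notin> \<rat>" "x \<noteq> 0" by simp_all
  obtain d where d: "s\<^sup>2 = of_rat d" using assms(1) by (rule Rats_cases)
  obtain p q where x: "x = of_rat p + of_rat q * s" using assms(2) by (rule quad_extE)
  \<comment> \<open>The conjugate of \<open>x\<close>; the norm \<open>x * x'\<close> is
    rational.\<close>
  define x' where "x' = of_rat p - of_rat q * s"
  have "x' \<noteq> 0"
  proof
    assume "x' = 0"
    then have "of_rat p + of_rat (- q) * s = 0" unfolding x'_def by (simp add: of_rat_minus)
    with \<open>s \<notin> \<rat>\<close> have "p = 0" "- q = 0" by (rule linear_independent_Rats)+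
    then show False using \<open>x \<noteq> 0\<close> x by simp
  qed
  have N: "x * x' = of_rat (p\<^sup>2 - q\<^sup>2 * d)"
    unfolding x x'_def of_rat_diff of_rat_mult of_rat_power d[symmetric]
    by (simp add: power2_eq_square algebra_simps)
  have "inverse x = inverse (x * x') * x'"
    using \<open>x' \<noteq> 0\<close> by (simp add: mult.assoc)
  also have "\<dots> = of_rat (inverse (p\<^sup>2 - q\<^sup>2 * d)) * x'"
    unfolding N of_rat_inverse ..
  also have "\<dots> = of_rat (inverse (p\<^sup>2 - q\<^sup>2 * d) * p) + of_rat (- inverse (p\<^sup>2 - q\<^sup>2 * d) * q) * s"
    unfolding x'_def of_rat_minus of_rat_mult by (simp add: algebra_simps)
  finally show ?thesis by (simp only: quad_extI)
qed

text \<open>Dictionary between record and type class operations. The clause on inverses is limited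
  to nonzero \<open>x\<close>, where uniqueness of inverses determines the value.\<close>

lemma type_algebra_simps:
  fixes x y :: "'a::field_char_0"
  defines "R \<equiv> (ring_of_type_algebra :: 'a ring)"
  shows "carrier R = UNIV" "\<one>\<^bsub>R\<^esub> = 1" "\<zero>\<^bsub>R\<^esub> = 0"
    "x \<oplus>\<^bsub>R\<^esub> y = x + y" "x \<otimes>\<^bsub>R\<^esub> y = x * y" "\<ominus>\<^bsub>R\<^esub> x = - x"
    "x \<noteq> 0 \<Longrightarrow> inv\<^bsub>R\<^esub> x = inverse x"
proof -
  interpret R: Ring.field R unfolding R_def by (rule field_from_type_algebra)
  show *: "carrier R = UNIV" "\<one>\<^bsub>R\<^esub> = 1" "\<zero>\<^bsub>R\<^esub> = 0"
    "x \<oplus>\<^bsub>R\<^esub> y = x + y" "x \<otimes>\<^bsub>R\<^esub> y = x * y" for x y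
    unfolding R_def by (simp_all add: ring_of_type_algebra_def)
  show "\<ominus>\<^bsub>R\<^esub> x = - x" by (rule R.minus_equality) (simp_all add: *)
  show "inv\<^bsub>R\<^esub> x = inverse x" if "x \<noteq> 0"
    using that by (intro R.comm_inv_char) (simp_all add: *)
qed

lemma subfield_type_algebra:
  fixes K :: "'a::field_char_0 set"
  assumes "subfield K ring_of_type_algebra"
  shows "1 \<in> K" "x \<in> K \<Longrightarrow> - x \<in> K" "x \<in> K \<Longrightarrow> y \<in> K \<Longrightarrow> x + y \<in> K"
    "x \<in> K \<Longrightarrow> y \<in> K \<Longrightarrow> x * y \<in> K" "x \<in> K \<Longrightarrow> inverse x \<in> K"
proof -
  interpret R: Ring.field "ring_of_type_algebra :: 'a ring" by (rule field_from_type_algebra)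
  note sub = subringE[OF subfieldE(1)[OF assms]]
  show "1 \<in> K" using sub(3) unfolding type_algebra_simps .
  show "x \<in> K \<Longrightarrow> - x \<in> K" using sub(5)[of x] unfolding type_algebra_simps .
  show "x \<in> K \<Longrightarrow> y \<in> K \<Longrightarrow> x * y \<in> K" using sub(6)[of x y] unfolding type_algebra_simps .
  show "x \<in> K \<Longrightarrow> y \<in> K \<Longrightarrow> x + y \<in> K" using sub(7)[of x y] unfolding type_algebra_simps .
  show "inverse x \<in> K" if "x \<in> K"
  proof (cases "x = 0")
    case False
    then show ?thesis using R.subfield_m_inv(1)[OF assms, of x] that by (simp add: type_algebra_simps)
  qed (use that in simp)
qed

lemma Rats_subset_subfield:
  fixes K :: "'a::field_char_0 set"
  assumes "subfield K ring_of_type_algebra"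
  shows "\<rat> \<subseteq> K"
proof
  note K = subfield_type_algebra[OF assms]
  fix x :: 'a assume "x \<in> \<rat>"
  then obtain a b where x: "x = of_int a / of_int b" by (auto elim: Rats_cases')
  have zero: "0 \<in> K" using K(3)[OF K(1) K(2)[OF K(1)]] by simp
  have nat: "of_nat n \<in> K" for n
    by (induction n) (simp_all add: zero K(1) K(3))
  have int: "of_int c \<in> K" for c
  proof (cases c)
    case (neg n)
    then show ?thesis using K(2)[OF nat[of "Suc n"]] by simp
  qed (simp add: nat)
  show "x \<in> K" unfolding x divide_inverse by (intro K(4,5) int)
qed

text \<open>\<open>quad_ext s\<close> is closed under the operations that generate the field;
  conversely a subfield containing \<open>s\<close> contains \<rat> and all rational combinations of
  1 and \<open>s\<close>.\<close>

lemma rat_adjoin_eq: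
  fixes s :: "'a::field_char_0"
  assumes "s\<^sup>2 \<in> \<rat>"
  shows "rat_adjoin s = quad_ext s"
proof
  interpret R: Ring.field "ring_of_type_algebra :: 'a ring" by (rule field_from_type_algebra)
  show "rat_adjoin s \<subseteq> quad_ext s"
  proof
    fix x assume "x \<in> rat_adjoin s"
    then show "x \<in> quad_ext s" unfolding rat_adjoin_def
    proof (induction rule: generate_field.induct)
      case one
      then show ?case using Rats_subset_quad_ext[of s] Rats_1 unfolding type_algebra_simps by (rule subsetD)
    next
      case (m_inv h)
      then show ?case using quad_ext_inverse[OF assms] by (simp add: type_algebra_simps)
    qed (use assms in \<open>simp_all add: type_algebra_simps quad_ext_self quad_ext_minus quad_ext_add quad_ext_mult\<close>)
  qed
  have sub: "subfield (rat_adjoin s) ring_of_type_algebra"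
    unfolding rat_adjoin_def by (rule R.generate_field_is_subfield) (simp add: type_algebra_simps)
  have "s \<in> rat_adjoin s" unfolding rat_adjoin_def by (rule generate_field.incl) simp
  moreover have "of_rat p \<in> rat_adjoin s" for p using Rats_subset_subfield[OF sub] by auto
  ultimately show "quad_ext s \<subseteq> rat_adjoin s"
    by (auto elim!: quad_extE intro!: subfield_type_algebra(3,4)[OF sub])
qed

text \<open>A two-element basis is exchanged for 1 and an irrational \<open>x\<close>; completing
  the square in the quadratic equation of \<open>x\<close> then gives \<open>s\<close>.\<close>

lemma quadratic_field_eq_quad_ext:
  fixes K :: "'a::field_char_0 set"
  assumes "quadratic_field K"
  obtains s where "s\<^sup>2 \<in> \<rat>" "s \<notin> \<rat>" "K = quad_ext s"
proof -
  interpret R: Ring.field "ring_of_type_algebra :: 'a ring" by (rule field_from_type_algebra)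
  have sub: "subfield K ring_of_type_algebra" and dim: "R.dimension 2 \<rat> K"
    using assms unfolding quadratic_field_def by auto
  note K = subfield_type_algebra[OF sub]
  \<comment> \<open>Unfolding the inductive \<open>dimension\<close> down to 0 exposes a basis
    \<open>v\<close>, \<open>v'\<close> over \<rat>.\<close>
  from dim obtain v E where v: "R.dimension 1 \<rat> E" "v \<notin> E" "K = R.line_extension \<rat> v E"
    by (cases rule: R.dimension.cases) (auto simp: numeral_2_eq_2)
  from v(1) obtain v' E' where v': "R.dimension 0 \<rat> E'" "v' \<notin> E'" "E = R.line_extension \<rat> v' E'"
    by (cases rule: R.dimension.cases) auto
  from v'(1) have E': "E' = {0}"
    by (cases rule: R.dimension.cases) (auto simp: type_algebra_simps)
  have E: "u \<in> E \<longleftrightarrow> (\<exists>k\<in>\<rat>. u = k * v')" for u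
    unfolding v'(3) R.line_extension_mem_iff E' by (simp add: type_algebra_simps)
  have Kv: "u \<in> K \<longleftrightarrow> (\<exists>k\<in>\<rat>. \<exists>l\<in>\<rat>. u = k * v + l * v')" for u
    unfolding v(3) R.line_extension_mem_iff Bex_def E type_algebra_simps by blast
  have "v' \<noteq> 0" using v'(2) E' by simp
  have indep: "k = 0 \<and> l = 0" if "k \<in> \<rat>" "l \<in> \<rat>" "k * v + l * v' = 0" for k l
  proof -
    have "k = 0"
    proof (rule ccontr)
      assume "k \<noteq> 0"
      then have "v = (- l / k) * v'" using that(3) by (simp add: field_simps eq_neg_iff_add_eq_0)
      then show False using v(2) E that by (metis Rats_divide Rats_minus_iff)
    qed
    then show ?thesis using that \<open>v' \<noteq> 0\<close> by simp
  qed
  have "v \<in> K" "v' \<in> K" unfolding Kv by (metis Rats_0 Rats_1 add_0 add_0_right mult_1 mult_zero_left)+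
  have "\<exists>x\<in>K. x \<notin> \<rat>"
  proof (rule ccontr)
    assume "\<not> ?thesis"
    then have "v \<in> \<rat>" "v' \<in> \<rat>" using \<open>v \<in> K\<close> \<open>v' \<in> K\<close> by auto
    \<comment> \<open>If both basis vectors were rational, \<open>v' * v + (- v) * v' = 0\<close>
      would be a nontrivial relation.\<close>
    then show False using indep[of v' "- v"] \<open>v' \<noteq> 0\<close> by simp
  qed
  then obtain x where x: "x \<in> K" "x \<notin> \<rat>" by blast
  obtain a b where ab: "a \<in> \<rat>" "b \<in> \<rat>" "1 = a * v + b * v'" using K(1) Kv by blast
  obtain c e where ce: "c \<in> \<rat>" "e \<in> \<rat>" "x = c * v + e * v'" using x(1) Kv by blast
  \<comment> \<open>Determinant of 1 and \<open>x\<close> in the basis; Cramer's rule expresses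
    \<open>v\<close> and \<open>v'\<close> through 1 and \<open>x\<close>.\<close>
  define D where "D = a * e - b * c"
  have "D \<in> \<rat>" unfolding D_def using ab ce by simp
  have vD: "D * v = e - b * x" "D * v' = a * x - c"
  proof -
    have "D * v = e * (a * v + b * v') - b * (c * v + e * v')"
      "D * v' = a * (c * v + e * v') - c * (a * v + b * v')"
      unfolding D_def by (simp_all add: algebra_simps)
    then show "D * v = e - b * x" "D * v' = a * x - c"
      unfolding ab(3)[symmetric] ce(3)[symmetric] by simp_all
  qed
  have "D \<noteq> 0"
  proof
    assume "D = 0"
    then have "e = b * x" "c = a * x" using vD by simp_all
    then have "b = 0" "a = 0" using ce(1,2) ab(1,2) x(2)
      by (metis Rats_divide nonzero_mult_div_cancel_left)+
    then show False using ab(3) by simp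
  qed
  have Kx: "\<exists>k\<in>\<rat>. \<exists>l\<in>\<rat>. u = k + l * x" if "u \<in> K" for u
  proof -
    obtain k l where kl: "k \<in> \<rat>" "l \<in> \<rat>" "u = k * v + l * v'" using \<open>u \<in> K\<close> Kv by blast
    have "D * u = k * (D * v) + l * (D * v')" unfolding kl by (simp add: algebra_simps)
    also have "\<dots> = (k * e - l * c) + (l * a - k * b) * x" unfolding vD by (simp add: algebra_simps)
    finally have "u = ((k * e - l * c) + (l * a - k * b) * x) / D"
      using \<open>D \<noteq> 0\<close> by (metis nonzero_mult_div_cancel_left)
    then have "u = (k * e - l * c) / D + (l * a - k * b) / D * x"
      by (simp add: add_divide_distrib)
    moreover have "(k * e - l * c) / D \<in> \<rat>" "(l * a - k * b) / D \<in> \<rat>"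
      using kl ab ce \<open>D \<in> \<rat>\<close> by simp_all
    ultimately show ?thesis by blast
  qed
  \<comment> \<open>Completing the square: \<open>s^2\<close> will be the discriminant
    \<open>4 * k + l^2\<close> of the equation of \<open>x\<close>.\<close>
  obtain k l where kl: "k \<in> \<rat>" "l \<in> \<rat>" "x * x = k + l * x" using Kx[OF K(4)[OF x(1) x(1)]] by blast
  define s where "s = 2 * x - l"
  have xs: "x = l / 2 + 1 / 2 * s" unfolding s_def by (simp add: diff_divide_distrib)
  have "s\<^sup>2 = 4 * (x * x) - 4 * l * x + l\<^sup>2" unfolding s_def by (simp add: power2_eq_square algebra_simps)
  also have "\<dots> = 4 * k + l\<^sup>2" unfolding kl(3) by (simp add: algebra_simps)
  finally have "s\<^sup>2 \<in> \<rat>" using kl by simp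
  moreover have "s \<notin> \<rat>"
  proof
    assume "s \<in> \<rat>"
    then have "x \<in> \<rat>" using kl(2) by (subst xs) simp
    then show False using x(2) by simp
  qed
  moreover have "K = quad_ext s"
  proof
    have "s = x + x + - l" unfolding s_def by simp
    then have "s \<in> K" using K x(1) kl(2) Rats_subset_subfield[OF sub] by (metis subsetD)
    moreover have "of_rat p \<in> K" for p using Rats_subset_subfield[OF sub] by auto
    ultimately show "quad_ext s \<subseteq> K" by (auto elim!: quad_extE intro!: K(3,4))
    show "K \<subseteq> quad_ext s"
    proof
      fix u assume "u \<in> K"
      then obtain k' l' where "k' \<in> \<rat>" "l' \<in> \<rat>" "u = k' + l' * x" using Kx by blast
      moreover from this have "u = (k' + l' * l / 2) + l' / 2 * s"
        by (subst (asm) xs) (simp add: field_simps)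
      moreover have "k' + l' * l / 2 \<in> \<rat>" "l' / 2 \<in> \<rat>" using calculation kl(2) by simp_all
      ultimately show "u \<in> quad_ext s" by (metis Rats_cases quad_extI)
    qed
  qed
  ultimately show thesis by (rule that)
qed

section \<open>Points of the curve over \<rat> and over quadratic fields\<close>

text \<open>Multiplied by \<open>x\<close>, the values 0, -4 and -8 of \<open>t = x - 1/x\<close>
  give the three quadratic equations, and \<open>3 * t = - 8\<close> gives
  \<open>(x + 3) * (3 * x - 1) = 0\<close>.\<close>

lemma curve_points_x_cases:
  fixes s :: "'a::field_char_0"
  assumes s: "s\<^sup>2 \<in> \<rat>" and P: "(x, y, z) \<in> curve_points (quad_ext s)"
  shows "x\<^sup>2 = 1 \<or> x\<^sup>2 + 4 * x - 1 = 0 \<or> x\<^sup>2 + 8 * x - 1 = 0 \<or> x = - 3 \<or> x = 1 / 3"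
proof -
  have mem: "x \<in> quad_ext s" "y \<in> quad_ext s" "z \<in> quad_ext s"
    and y: "y\<^sup>2 = 2 * (x^4 + 2 * x^3 - 2 * x + 1)"
    and z: "z\<^sup>2 = 5 * x^4 + 8 * x^3 + 6 * x\<^sup>2 - 8 * x + 5"
    using P unfolding curve_points_def by auto
  \<comment> \<open>A point with \<open>x = 0\<close> would put square roots of 2 and 5 into one
    quadratic field.\<close>
  have "x \<noteq> 0"
  proof
    assume "x = 0"
    then have yz: "y\<^sup>2 = of_int 2" "z\<^sup>2 = of_int 5" using y z by simp_all
    have "y \<notin> \<rat>" using yz(1) by (rule irrational_sqrt) (simp only: rat_square_neq insert_iff simp_thms)
    then have "z \<in> quad_ext y" using quad_ext_eqI mem by metis
    then show False using yz(2,1)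
      by (rule no_simultaneous_square_roots) (use rat_square_neq[of 5] rat_square_neq[of 10] in auto)
  qed
  define w where "w = inverse x"
  have w: "x * w = 1" using \<open>x \<noteq> 0\<close> unfolding w_def by simp
  have wmem: "w \<in> quad_ext s" unfolding w_def using s mem(1) by (rule quad_ext_inverse)
  define t where "t = x - w"
  have xt: "x * t = x\<^sup>2 - 1" unfolding t_def using w by (simp add: power2_eq_square algebra_simps)
  have "t = 0 \<or> t = - 4 \<or> t = - 8 \<or> 3 * t = - 8"
  proof (rule rational_parameter_cases[OF s, of t "x + w" "y * w" "z * w"])
    show "t \<in> quad_ext s" "x + w \<in> quad_ext s" "y * w \<in> quad_ext s" "z * w \<in> quad_ext s"
      unfolding t_def using s mem wmem by (simp_all add: quad_ext_diff quad_ext_add quad_ext_mult)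
    show "(x + w)\<^sup>2 = t\<^sup>2 + 4" unfolding t_def using w by (simp add: power2_eq_square algebra_simps)
    \<comment> \<open>Both right-hand sides of the curve are quadratic forms in
      \<open>x^2 - 1 = x * t\<close> and \<open>x\<close>.\<close>
    have "y\<^sup>2 = 2 * (x * t)\<^sup>2 + 4 * x * (x * t) + 4 * x\<^sup>2"
      unfolding y xt by (simp add: eval_nat_numeral algebra_simps)
    then have "(y * w)\<^sup>2 = (2 * t\<^sup>2 + 4 * t + 4) * (x * w)\<^sup>2"
      unfolding power_mult_distrib by (simp add: power2_eq_square algebra_simps)
    then show "(y * w)\<^sup>2 = 2 * t\<^sup>2 + 4 * t + 4" unfolding w by simp
    have "z\<^sup>2 = 5 * (x * t)\<^sup>2 + 8 * x * (x * t) + 16 * x\<^sup>2"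
      unfolding z xt by (simp add: eval_nat_numeral algebra_simps)
    then have "(z * w)\<^sup>2 = (5 * t\<^sup>2 + 8 * t + 16) * (x * w)\<^sup>2"
      unfolding power_mult_distrib by (simp add: power2_eq_square algebra_simps)
    then show "(z * w)\<^sup>2 = 5 * t\<^sup>2 + 8 * t + 16" unfolding w by simp
  qed
  then have "x * t = 0 \<or> x * t = x * - 4 \<or> x * t = x * - 8 \<or> x * (3 * t) = x * - 8"
    by auto
  then have "x\<^sup>2 - 1 = 0 \<or> x\<^sup>2 - 1 = x * - 4 \<or> x\<^sup>2 - 1 = x * - 8 \<or> 3 * (x\<^sup>2 - 1) = x * - 8"
    unfolding mult.left_commute[of x 3] xt .
  then show ?thesis
  proof (elim disjE)
    assume *: "3 * (x\<^sup>2 - 1) = x * - 8"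
    have "(x + 3) * (3 * x - 1) = 3 * (x\<^sup>2 - 1) - x * - 8"
      by (simp add: power2_eq_square algebra_simps)
    then have "x + 3 = 0 \<or> 3 * x - 1 = 0" unfolding * by simp
    then show ?thesis by (auto simp: eq_neg_iff_add_eq_0 eq_divide_eq mult.commute)
  qed (simp_all add: algebra_simps)
qed

lemma curve_points_x_square_eq_1:
  assumes "x\<^sup>2 = 1" "(x, y, z) \<in> curve_points K"
  shows "x \<in> {1, -1} \<and> y \<in> {2, -2} \<and> z \<in> {4, -4}"
proof -
  have x: "x \<in> {1, -1}" using assms(1) by (simp add: power2_eq_1_iff)
  then have "y\<^sup>2 = 2\<^sup>2" "z\<^sup>2 = 4\<^sup>2" using assms(2) unfolding curve_points_def by auto
  then show ?thesis using x unfolding power2_eq_iff by simp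
qed

text \<open>The choice \<open>s = 0\<close> makes \<open>quad_ext s\<close> equal to \<rat>. Every
  value of \<open>x\<close> other than 1 and -1 would give a rational square root of 5 or
  17.\<close>

lemma curve_points_Rats:
  "curve_points (\<rat> :: 'a::field_char_0 set) =
     {(x, y, z). x \<in> {1, -1} \<and> y \<in> {2, -2} \<and> z \<in> {4, -4}}" (is "_ = ?S")
proof
  show "?S \<subseteq> curve_points \<rat>" unfolding curve_points_def by auto
  show "curve_points \<rat> \<subseteq> ?S"
  proof
    fix P :: "'a \<times> 'a \<times> 'a" assume P: "P \<in> curve_points \<rat>"
    obtain x y z where xyz: "P = (x, y, z)" by (cases P)
    have mem: "x \<in> \<rat>" "y \<in> \<rat>" and y: "y\<^sup>2 = 2 * (x^4 + 2 * x^3 - 2 * x + 1)"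
      using P unfolding xyz curve_points_def by auto
    have no_sqrt: "r\<^sup>2 \<noteq> of_int n" if "r \<in> \<rat>" "n \<in> {5, 17}" for r :: 'a and n
      using irrational_sqrt[of r n] rat_square_neq[of n] that by auto
    have "quad_ext (0 :: 'a) = \<rat>" by (rule quad_ext_rational) simp
    then have "x\<^sup>2 = 1 \<or> x\<^sup>2 + 4 * x - 1 = 0 \<or> x\<^sup>2 + 8 * x - 1 = 0 \<or> x = - 3 \<or> x = 1 / 3"
      using curve_points_x_cases[of 0 x y z] P unfolding xyz by simp
    moreover have "x\<^sup>2 + 4 * x - 1 \<noteq> 0"
      using no_sqrt[of "x + 2" 5] mem by (simp add: power2_eq_square algebra_simps)
    moreover have "x\<^sup>2 + 8 * x - 1 \<noteq> 0"
      using no_sqrt[of "x + 4" 17] mem by (simp add: power2_eq_square algebra_simps)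
    moreover have "x \<noteq> - 3"
      using no_sqrt[of "y / 2" 17] mem y by (auto simp: power_divide)
    moreover have "x \<noteq> 1 / 3"
    proof
      assume "x = 1 / 3"
      then have "(9 * y / 2)\<^sup>2 = of_int 17"
        using y by (simp only: power_divide power_mult_distrib) simp
      then show False using no_sqrt[of "9 * y / 2" 17] mem by simp
    qed
    ultimately have "x\<^sup>2 = 1" by blast
    then show "P \<in> ?S" using curve_points_x_square_eq_1 P unfolding xyz by blast
  qed
qed

text \<open>Every further point exhibits a square root of 5 or 17 in the field: from the equation of
  \<open>x\<close> by completing the square, or, for \<open>x = -3\<close> and
  \<open>x = 1/3\<close>, from \<open>y^2 = 68\<close> and \<open>y^2 = 68/81\<close>.\<close>

lemma irrational_point_cases:
  fixes s :: "'a::field_char_0"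
  assumes s: "s\<^sup>2 \<in> \<rat>" and P: "(x, y, z) \<in> curve_points (quad_ext s) - curve_points \<rat>"
  obtains "x\<^sup>2 + 4 * x - 1 = 0" "x + 2 \<in> quad_ext s" "(x + 2)\<^sup>2 = 5"
  | "x\<^sup>2 + 8 * x - 1 = 0" "x + 4 \<in> quad_ext s" "(x + 4)\<^sup>2 = 17"
  | "x = -3" "y / 2 \<in> quad_ext s" "(y / 2)\<^sup>2 = 17"
  | "x = 1 / 3" "9 * y / 2 \<in> quad_ext s" "(9 * y / 2)\<^sup>2 = 17"
proof -
  have mem: "x \<in> quad_ext s" "y \<in> quad_ext s" and y: "y\<^sup>2 = 2 * (x^4 + 2 * x^3 - 2 * x + 1)"
    using P unfolding curve_points_def by auto
  have rat: "of_int n \<in> quad_ext s" "of_int n / of_int m \<in> quad_ext s" for n m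
    using Rats_subset_quad_ext[of s] by auto
  have mem': "x + 2 \<in> quad_ext s" "x + 4 \<in> quad_ext s" "1 / 2 * y \<in> quad_ext s" "9 / 2 * y \<in> quad_ext s"
    using quad_ext_add[OF mem(1) rat(1)[of 2]] quad_ext_add[OF mem(1) rat(1)[of 4]]
      quad_ext_mult[OF s rat(2)[of 1 2] mem(2)] quad_ext_mult[OF s rat(2)[of 9 2] mem(2)] by simp_all
  have "x\<^sup>2 \<noteq> 1"
    using curve_points_x_square_eq_1[of x y z] P curve_points_Rats by blast
  then consider "x\<^sup>2 + 4 * x - 1 = 0" | "x\<^sup>2 + 8 * x - 1 = 0" | "x = -3" | "x = 1 / 3"
    using curve_points_x_cases[OF s, of x y z] P by blast
  then show thesis
  proof cases
    case 1
    then show thesis using mem' by (intro that(1)) (simp_all add: power2_eq_square algebra_simps)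
  next
    case 2
    then show thesis using mem' by (intro that(2)) (simp_all add: power2_eq_square algebra_simps)
  next
    case 3
    then show thesis using mem' y by (intro that(3)) (simp_all add: power_divide)
  next
    case 4
    then have "(9 * y / 2)\<^sup>2 = 17"
      using y by (simp only: power_divide power_mult_distrib) simp
    then show thesis using 4 mem'(4) by (intro that(4)) simp_all
  qed
qed

lemma curve_values:
  fixes x :: "'a::field_char_0"
  defines "f \<equiv> 2 * (x^4 + 2 * x^3 - 2 * x + 1)" and "g \<equiv> 5 * x^4 + 8 * x^3 + 6 * x\<^sup>2 - 8 * x + 5"
  shows "x\<^sup>2 + 4 * x - 1 = 0 \<Longrightarrow> f = (4 * x - 2)\<^sup>2" "x\<^sup>2 + 4 * x - 1 = 0 \<Longrightarrow> g = (8 * x)\<^sup>2"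
    "x\<^sup>2 + 8 * x - 1 = 0 \<Longrightarrow> f = (10 * x)\<^sup>2" "x\<^sup>2 + 8 * x - 1 = 0 \<Longrightarrow> g = (16 * x - 4)\<^sup>2"
proof -
  \<comment> \<open>Polynomial division by the quadratic equation of \<open>x\<close>.\<close>
  have "f - (4 * x - 2)\<^sup>2 = (x\<^sup>2 + 4 * x - 1) * (2 * x\<^sup>2 - 4 * x + 2)"
    "g - (8 * x)\<^sup>2 = (x\<^sup>2 + 4 * x - 1) * (5 * x\<^sup>2 - 12 * x - 5)"
    "f - (10 * x)\<^sup>2 = (x\<^sup>2 + 8 * x - 1) * (2 * x\<^sup>2 - 12 * x - 2)"
    "g - (16 * x - 4)\<^sup>2 = (x\<^sup>2 + 8 * x - 1) * (5 * x\<^sup>2 - 32 * x + 11)"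
    unfolding f_def g_def by (simp_all add: eval_nat_numeral algebra_simps)
  then show "x\<^sup>2 + 4 * x - 1 = 0 \<Longrightarrow> f = (4 * x - 2)\<^sup>2" "x\<^sup>2 + 4 * x - 1 = 0 \<Longrightarrow> g = (8 * x)\<^sup>2"
    "x\<^sup>2 + 8 * x - 1 = 0 \<Longrightarrow> f = (10 * x)\<^sup>2" "x\<^sup>2 + 8 * x - 1 = 0 \<Longrightarrow> g = (16 * x - 4)\<^sup>2"
    by simp_all
qed

lemma curve_points_over_x:
  assumes "2 * (x^4 + 2 * x^3 - 2 * x + 1) = v\<^sup>2" "5 * x^4 + 8 * x^3 + 6 * x\<^sup>2 - 8 * x + 5 = w\<^sup>2"
  shows "(x, y, z) \<in> curve_points K \<longleftrightarrow> x \<in> K \<and> y \<in> K \<and> z \<in> K \<and> y \<in> {v, - v} \<and> z \<in> {w, - w}"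
  unfolding curve_points_def using assms by (auto simp: power2_eq_iff)

text \<open>A further point would yield an irrational \<open>r\<close> in \<open>K\<close> with
  square 5 or 17, and any irrational element generates \<open>K\<close>, so
  \<open>K = rat_adjoin r\<close>.\<close>

lemma curve_points_other_field:
  fixes K :: "'a::field_char_0 set"
  assumes K: "quadratic_field K" and "\<And>s. s\<^sup>2 = 5 \<Longrightarrow> K \<noteq> rat_adjoin s" "\<And>s. s\<^sup>2 = 17 \<Longrightarrow> K \<noteq> rat_adjoin s"
  shows "curve_points K = curve_points \<rat>"
proof -
  obtain s where s: "s\<^sup>2 \<in> \<rat>" "s \<notin> \<rat>" "K = quad_ext s" using quadratic_field_eq_quad_ext[OF K] .
  have no_sqrt: False if "n \<in> {5, 17}" "r \<in> K" "r\<^sup>2 = of_int n" for r n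
  proof -
    have "r \<notin> \<rat>" using irrational_sqrt[OF that(3)] rat_square_neq[of n] that(1) by auto
    then have "K = quad_ext r" using quad_ext_eqI[of r s] that(2) s(3) by simp
    also have "\<dots> = rat_adjoin r" using rat_adjoin_eq[of r] that(3) by simp
    finally show False using assms(2,3)[of r] that by auto
  qed
  have "curve_points K - curve_points \<rat> = {}"
  proof (rule equals0I)
    fix P assume P: "P \<in> curve_points K - curve_points \<rat>"
    obtain x y z where xyz: "P = (x, y, z)" by (cases P)
    show False
      by (rule irrational_point_cases[OF s(1) P[unfolded xyz s(3)]])
        (use no_sqrt[of 5 "x + 2"] no_sqrt[of 17 "x + 4"] no_sqrt[of 17 "y / 2"]
          no_sqrt[of 17 "9 * y / 2"] s(3) in simp_all)
  qed
  moreover have "curve_points \<rat> \<subseteq> curve_points K"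
    using Rats_subset_quad_ext[of s] unfolding s(3) curve_points_def by auto
  ultimately show ?thesis by blast
qed

lemma curve_points_sqrt_5:
  fixes s :: "'a::field_char_0"
  assumes s: "s\<^sup>2 = 5"
  shows "curve_points (rat_adjoin s) - curve_points \<rat> =
    {(x, y, z). x\<^sup>2 + 4 * x - 1 = 0 \<and> y \<in> {4 * x - 2, - (4 * x - 2)} \<and> z \<in> {8 * x, - (8 * x)}}"
proof -
  have s': "s\<^sup>2 = of_int 5" "s\<^sup>2 \<in> \<rat>" using s by simp_all
  \<comment> \<open>Otherwise 17 or 85 would be a rational square. Only the first alternative of
    \<open>irrational_point_cases\<close> survives.\<close>
  have no_17: False if "r \<in> quad_ext s" "r\<^sup>2 = 17" for r
    by (rule no_simultaneous_square_roots[of r s 17 5])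
      (use that s rat_square_neq[of 17] rat_square_neq[of 85] in auto)
  have "(x, y, z) \<in> curve_points (quad_ext s) - curve_points \<rat> \<longleftrightarrow>
      x\<^sup>2 + 4 * x - 1 = 0 \<and> y \<in> {4 * x - 2, - (4 * x - 2)} \<and> z \<in> {8 * x, - (8 * x)}" (is "?l \<longleftrightarrow> ?r") for x y z
  proof
    assume P: ?l
    have x: "x\<^sup>2 + 4 * x - 1 = 0" by (rule irrational_point_cases[OF s'(2) P]) (use no_17 in auto)
    then show ?r using P curve_points_over_x[OF curve_values(1,2)[OF x]] by simp
  next
    assume P: ?r
    then have x: "x\<^sup>2 + 4 * x - 1 = 0" by blast
    then have "(x + 2)\<^sup>2 = s\<^sup>2" using s by (simp add: power2_eq_square algebra_simps)
    then have "x = of_rat (- 2) + of_rat 1 * s \<or> x = of_rat (- 2) + of_rat (- 1) * s"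
      unfolding power2_eq_iff by (auto simp: of_rat_minus algebra_simps eq_diff_eq)
    then have xs: "x \<in> quad_ext s" using quad_extI by metis
    have rat: "of_int n \<in> quad_ext s" for n using Rats_subset_quad_ext[of s] by auto
    have "4 * x - 2 \<in> quad_ext s" "8 * x \<in> quad_ext s"
      using quad_ext_diff[OF quad_ext_mult[OF s'(2) rat[of 4] xs] rat[of 2]] quad_ext_mult[OF s'(2) rat[of 8] xs]
      by simp_all
    moreover from this have "- (4 * x - 2) \<in> quad_ext s" "- (8 * x) \<in> quad_ext s"
      by (simp_all only: quad_ext_minus)
    ultimately have "(x, y, z) \<in> curve_points (quad_ext s)"
      using P xs unfolding curve_points_over_x[OF curve_values(1,2)[OF x]] by blast
    moreover have "(x, y, z) \<notin> curve_points \<rat>"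
      using x unfolding curve_points_Rats by auto
    ultimately show ?l by blast
  qed
  then show ?thesis unfolding rat_adjoin_eq[OF s'(2)] by auto
qed

lemma curve_points_sqrt_17:
  fixes s :: "'a::field_char_0"
  assumes s: "s\<^sup>2 = 17"
  shows "curve_points (rat_adjoin s) - curve_points \<rat> =
    {(x, y, z). x = -3 \<and> y \<in> {2 * s, - (2 * s)} \<and> z \<in> {4 * s, - (4 * s)}}
    \<union> {(x, y, z). x = 1/3 \<and> y \<in> {2 * s / 9, - (2 * s / 9)} \<and> z \<in> {4 * s / 9, - (4 * s / 9)}}
    \<union> {(x, y, z). x\<^sup>2 + 8 * x - 1 = 0 \<and> y \<in> {10 * x, - (10 * x)} \<and> z \<in> {16 * x - 4, - (16 * x - 4)}}"
proof -
  have s': "s\<^sup>2 = of_int 17" "s\<^sup>2 \<in> \<rat>" using s by simp_all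
  \<comment> \<open>Otherwise 5 or 85 would be a rational square; this discards the alternative with
    \<open>x^2 + 4 * x - 1 = 0\<close>.\<close>
  have no_5: False if "r \<in> quad_ext s" "r\<^sup>2 = 5" for r
    by (rule no_simultaneous_square_roots[of r s 5 17])
      (use that s rat_square_neq[of 5] rat_square_neq[of 85] in auto)
  have rat: "of_int n \<in> quad_ext s" "of_int n / of_int m \<in> quad_ext s" for n m
    using Rats_subset_quad_ext[of s] by auto
  have smult: "of_int n * s \<in> quad_ext s" "of_int n / of_int m * s \<in> quad_ext s" for n m
    by (intro quad_ext_mult s' rat quad_ext_self)+
  have s1: "2 * s \<in> quad_ext s" "4 * s \<in> quad_ext s" "2 * s / 9 \<in> quad_ext s" "4 * s / 9 \<in> quad_ext s"
    using smult(1)[of 2] smult(1)[of 4] smult(2)[of 2 9] smult(2)[of 4 9] by simp_all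
  note s2 = s1[THEN quad_ext_minus]
  \<comment> \<open>At \<open>x = -3\<close> the right-hand sides are \<open>68 = (2 * s)^2\<close>
    and \<open>272 = (4 * s)^2\<close>; at \<open>x = 1/3\<close> they are these values divided by
    81.\<close>
  have m3: "(- 3, y, z) \<in> curve_points K \<longleftrightarrow> - 3 \<in> K \<and> y \<in> K \<and> z \<in> K \<and> y \<in> {2 * s, - (2 * s)} \<and> z \<in> {4 * s, - (4 * s)}"
    for y z K by (rule curve_points_over_x) (simp_all add: power_mult_distrib s)
  have third: "(1 / 3, y, z) \<in> curve_points K \<longleftrightarrow>
      1 / 3 \<in> K \<and> y \<in> K \<and> z \<in> K \<and> y \<in> {2 * s / 9, - (2 * s / 9)} \<and> z \<in> {4 * s / 9, - (4 * s / 9)}"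
    for y z K by (rule curve_points_over_x) (simp_all add: power_mult_distrib power_divide s)
  have "(x, y, z) \<in> curve_points (quad_ext s) - curve_points \<rat> \<longleftrightarrow>
      x = -3 \<and> y \<in> {2 * s, - (2 * s)} \<and> z \<in> {4 * s, - (4 * s)}
      \<or> x = 1/3 \<and> y \<in> {2 * s / 9, - (2 * s / 9)} \<and> z \<in> {4 * s / 9, - (4 * s / 9)}
      \<or> x\<^sup>2 + 8 * x - 1 = 0 \<and> y \<in> {10 * x, - (10 * x)} \<and> z \<in> {16 * x - 4, - (16 * x - 4)}"
    (is "?l \<longleftrightarrow> ?r") for x y z
  proof
    assume P: ?l
    consider "x = -3" | "x = 1 / 3" | "x\<^sup>2 + 8 * x - 1 = 0"
      by (rule irrational_point_cases[OF s'(2) P]) (use no_5 in auto)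
    then show ?r
    proof cases
      case 1
      then show ?thesis using P m3[of y z "quad_ext s"] by blast
    next
      case 2
      then show ?thesis using P third[of y z "quad_ext s"] by blast
    next
      case 3
      then show ?thesis using P curve_points_over_x[OF curve_values(3,4)[OF 3]] by simp
    qed
  next
    assume ?r
    then consider (a) "x = -3" "y \<in> {2 * s, - (2 * s)}" "z \<in> {4 * s, - (4 * s)}"
      | (b) "x = 1/3" "y \<in> {2 * s / 9, - (2 * s / 9)}" "z \<in> {4 * s / 9, - (4 * s / 9)}"
      | (c) "x\<^sup>2 + 8 * x - 1 = 0" "y \<in> {10 * x, - (10 * x)}" "z \<in> {16 * x - 4, - (16 * x - 4)}"
      by blast
    then show ?l
    proof cases
      case a
      have "(x, y, z) \<in> curve_points (quad_ext s)"
        using a s1 s2 rat(1)[of "-3"] unfolding a(1) m3 by auto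
      then show ?thesis using a(1) unfolding curve_points_Rats by auto
    next
      case b
      have "(x, y, z) \<in> curve_points (quad_ext s)"
        using b(2,3) s1 s2 rat(2)[of 1 3] unfolding b(1) third of_int_1 of_int_numeral by blast
      moreover have "(x, y, z) \<notin> curve_points \<rat>"
        unfolding curve_points_Rats b(1) by simp
      ultimately show ?thesis by blast
    next
      case c
      then have "(x + 4)\<^sup>2 = s\<^sup>2" using s by (simp add: power2_eq_square algebra_simps)
      then have "x = of_rat (- 4) + of_rat 1 * s \<or> x = of_rat (- 4) + of_rat (- 1) * s"
        unfolding power2_eq_iff by (auto simp: of_rat_minus algebra_simps eq_diff_eq)
      then have xs: "x \<in> quad_ext s" using quad_extI by metis
      have "16 * x - 4 \<in> quad_ext s" "10 * x \<in> quad_ext s"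
        using quad_ext_diff[OF quad_ext_mult[OF s'(2) rat(1)[of 16] xs] rat(1)[of 4]]
          quad_ext_mult[OF s'(2) rat(1)[of 10] xs] by simp_all
      moreover from this have "- (16 * x - 4) \<in> quad_ext s" "- (10 * x) \<in> quad_ext s"
        by (simp_all only: quad_ext_minus)
      ultimately have "(x, y, z) \<in> curve_points (quad_ext s)"
        using c(2,3) xs unfolding curve_points_over_x[OF curve_values(3,4)[OF c(1)]] by blast
      moreover have "(x, y, z) \<notin> curve_points \<rat>"
        using c(1) unfolding curve_points_Rats by auto
      ultimately show ?thesis by blast
    qed
  qed
  then show ?thesis unfolding rat_adjoin_eq[OF s'(2)] by auto
qed

text \<open>Quantifying over \<open>s\<close> accommodates ambient fields without a square root of 5
  or 17, where the corresponding clauses hold vacuously.\<close>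

theorem theorem3p47:
  shows "curve_points (\<rat> :: 'a::field_char_0 set) =
           {(x, y, z). x \<in> {1, -1} \<and> y \<in> {2, -2} \<and> z \<in> {4, -4}}
    \<and> (\<forall>K :: 'a set. quadratic_field K \<and>
           (\<forall>s. s^2 = 5 \<longrightarrow> K \<noteq> rat_adjoin s) \<and> (\<forall>s. s^2 = 17 \<longrightarrow> K \<noteq> rat_adjoin s) \<longrightarrow>
           curve_points K = curve_points \<rat>)
    \<and> (\<forall>s :: 'a. s^2 = 5 \<longrightarrow>
           curve_points (rat_adjoin s) - curve_points \<rat> =
             {(x, y, z). x^2 + 4 * x - 1 = 0 \<and>
                y \<in> {4 * x - 2, - (4 * x - 2)} \<and> z \<in> {8 * x, - (8 * x)}})
    \<and> (\<forall>s :: 'a. s^2 = 17 \<longrightarrow>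
           curve_points (rat_adjoin s) - curve_points \<rat> =
             {(x, y, z). x = -3 \<and> y \<in> {2 * s, - (2 * s)} \<and> z \<in> {4 * s, - (4 * s)}}
             \<union> {(x, y, z). x = 1/3 \<and> y \<in> {2 * s / 9, - (2 * s / 9)} \<and>
                  z \<in> {4 * s / 9, - (4 * s / 9)}}
             \<union> {(x, y, z). x^2 + 8 * x - 1 = 0 \<and>
                  y \<in> {10 * x, - (10 * x)} \<and> z \<in> {16 * x - 4, - (16 * x - 4)}})"
  by (intro conjI allI impI curve_points_Rats curve_points_other_field curve_points_sqrt_5
      curve_points_sqrt_17) auto

end
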